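(* A ring $R$ is Zhou nil-clean if and only if (1) $R$ is an exchange ring, and (2) $R$ is a Kosan ring.
   Context: All rings are associative with an identity, not necessarily commutative. An element $t$ of a ring is tripotent if $t^3=t$. A ring $R$ is Zhou nil-clean if every element of $R$ is the sum of two tripotents and a nilpotent that (pairwise) commute. A ring $R$ is an exchange ring if for any $a\in R$ there exists an idempotent $e\in R$ such that $e\in aR$ and $1-e\in (1-a)R$. An element $u$ of a ring is unipotent if $u-1$ is nilpotent. A ring $R$ is a Kosan ring if for every unit $u$ of $R$, $u^4$ is unipotent. *)

theory Defs
  imports "HOL-Algebra.Ring"
begin

text \<open>
  Rings are those of the locale \<^locale>\<open>ring\<close>: associative, with identity, not necessarily
  commutative; the zero ring is allowed. The definitions below are meant for such rings, and
  do not themselves assert that \<open>R\<close> is one.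
\<close>

definition idempotent_elem :: "('a, 'b) ring_scheme \<Rightarrow> 'a \<Rightarrow> bool" where
  "idempotent_elem R e \<longleftrightarrow> e \<in> carrier R \<and> e \<otimes>\<^bsub>R\<^esub> e = e"

definition tripotent_elem :: "('a, 'b) ring_scheme \<Rightarrow> 'a \<Rightarrow> bool" where
  "tripotent_elem R t \<longleftrightarrow> t \<in> carrier R \<and> t [^]\<^bsub>R\<^esub> (3::nat) = t"

text \<open>The exponent \<open>0\<close> can only witness nilpotency in the zero ring.\<close>

definition nilpotent_elem :: "('a, 'b) ring_scheme \<Rightarrow> 'a \<Rightarrow> bool" where
  "nilpotent_elem R x \<longleftrightarrow> x \<in> carrier R \<and> (\<exists>n::nat. x [^]\<^bsub>R\<^esub> n = \<zero>\<^bsub>R\<^esub>)"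

definition unipotent_elem :: "('a, 'b) ring_scheme \<Rightarrow> 'a \<Rightarrow> bool" where
  "unipotent_elem R u \<longleftrightarrow> u \<in> carrier R \<and> nilpotent_elem R (u \<ominus>\<^bsub>R\<^esub> \<one>\<^bsub>R\<^esub>)"

definition zhou_nil_clean :: "('a, 'b) ring_scheme \<Rightarrow> bool" where
  "zhou_nil_clean R \<longleftrightarrow>
    (\<forall>a\<in>carrier R. \<exists>p q w.
       tripotent_elem R p \<and> tripotent_elem R q \<and> nilpotent_elem R w \<and>
       p \<otimes>\<^bsub>R\<^esub> q = q \<otimes>\<^bsub>R\<^esub> p \<and>
       p \<otimes>\<^bsub>R\<^esub> w = w \<otimes>\<^bsub>R\<^esub> p \<and>
       q \<otimes>\<^bsub>R\<^esub> w = w \<otimes>\<^bsub>R\<^esub> q \<and>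
       a = p \<oplus>\<^bsub>R\<^esub> q \<oplus>\<^bsub>R\<^esub> w)"

definition exchange_ring :: "('a, 'b) ring_scheme \<Rightarrow> bool" where
  "exchange_ring R \<longleftrightarrow>
    (\<forall>a\<in>carrier R. \<exists>e. idempotent_elem R e \<and>
       (\<exists>r\<in>carrier R. e = a \<otimes>\<^bsub>R\<^esub> r) \<and>
       (\<exists>s\<in>carrier R. \<one>\<^bsub>R\<^esub> \<ominus>\<^bsub>R\<^esub> e = (\<one>\<^bsub>R\<^esub> \<ominus>\<^bsub>R\<^esub> a) \<otimes>\<^bsub>R\<^esub> s))"

definition kosan_ring :: "('a, 'b) ring_scheme \<Rightarrow> bool" where
  "kosan_ring R \<longleftrightarrow> (\<forall>u\<in>Units R. unipotent_elem R (u [^]\<^bsub>R\<^esub> (4::nat)))"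

end

theory Submission
  imports Defs "HOL-Computational_Algebra.Polynomial" "HOL-Algebra.QuotRing"
    "HOL-Algebra.Multiplicative_Group"
begin

text \<open>
  Both sides are equivalent to a third condition: \<open>a^5 - a\<close> is nilpotent for every \<open>a\<close>.

  If \<open>a = p + q + w\<close> with commuting tripotents \<open>p, q\<close> and a nilpotent \<open>w\<close>, then in every domain
  quotient \<open>a\<close> takes one of the values \<open>0, 1, -1, 2, -2\<close>, so \<open>a (a\<^sup>2 - 1) (a\<^sup>2 - 4)\<close> is nilpotent.
  For \<open>a = 3\<close> this is \<open>120\<close>, so \<open>30\<close> is nilpotent. Hence the subring generated by
  \<open>p, q, w\<close> has only \<open>F\<^sub>2, F\<^sub>3, F\<^sub>5\<close> as residue fields, and in these \<open>x^5 = x\<close>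
  (\<open>zhou_nil_clean_fifth_power\<close>). Conversely, nilpotence of all \<open>a^5 - a\<close> makes
  \<open>30 = 2^5 - 2\<close> nilpotent and allows only the prime fields \<open>F\<^sub>2, F\<^sub>3, F\<^sub>5\<close> as residue fields of the
  commutative subring generated by \<open>a\<close>. Lagrange interpolation then gives, modulo nilpotents,
  orthogonal idempotents \<open>e\<^sub>c\<close> with \<open>a = e\<^sub>1 - e\<^sub>-\<^sub>1 + 2 e\<^sub>2 - 2 e\<^sub>-\<^sub>2\<close>; they lift to genuine
  orthogonal idempotents, and \<open>2 = 1 + 1\<close> splits the sum into two tripotents
  (\<open>sum_of_two_tripotents\<close>).

  If \<open>a^5 - a\<close> is always nilpotent, then for a unit \<open>u\<close> so is \<open>u^4 - 1\<close>. Moreover \<open>a^4\<close> is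
  idempotent modulo nilpotents; it lifts to an idempotent that is a multiple of \<open>a\<close> and whose
  complement is a multiple of \<open>1 - a\<close>, which is the exchange property
  (\<open>comaximal_powers_idempotent\<close>).

  The substantial direction starts from an exchange Kosan ring \<open>R\<close> with Jacobson radical \<open>J\<close>.
  The Kosan condition on the units \<open>1 + j\<close>, \<open>1 - j\<close> makes \<open>J\<close> nil, so it suffices to prove
  \<open>a^5 = a\<close> in \<open>R / J\<close>. That ring is again Kosan, and the exchange property provides a nonzero
  idempotent in each of its nonzero right ideals. It is reduced: otherwise a square-zero element
  together with such an idempotent generates 2 by 2 matrix units, and the integer matrices of
  order three and of Fibonacci type are units whose fourth powers make \<open>3\<close> and \<open>5\<close> nilpotent in
  that corner (\<open>kosan_ring_no_matrix_units\<close>). In a reduced ring idempotents are central. If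
  \<open>a^5 - a\<close> were nonzero there, a multiple of it would be a nonzero central idempotent \<open>e\<close>; then
  \<open>a e\<close> is a unit of the corner, so \<open>a^4 e = e\<close> by the Kosan condition, and \<open>a^5 - a\<close> vanishes on
  \<open>e\<close>, a contradiction (\<open>kosan_semipotent_fifth_power\<close>).

  Calculations with finitely many commuting elements are carried out in a polynomial ring over
  the integers, where the arithmetic of commutative rings is available; the locale
  \<open>commutative_image\<close> transfers their outcome to \<open>R\<close>.
\<close>

section \<open>Commuting elements as values of polynomials\<close>

text \<open>
  A ring homomorphism from a commutative ring, given as a type, to a possibly noncommutative ring.
  It serves to prove identities between commuting elements of \<open>R\<close> in the commutative ring: an
  identity there, modulo the kernel of \<open>\<phi>\<close> or modulo the ideal \<open>nil\<close> below, says something about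
  \<open>R\<close>.
\<close>

locale commutative_image = ring R for R :: "('a, 'b) ring_scheme" (structure) +
  fixes \<phi> :: "'c::comm_ring_1 \<Rightarrow> 'a"
  assumes image_closed [simp, intro]: "\<phi> x \<in> carrier R"
    and image_add: "\<phi> (x + y) = \<phi> x \<oplus> \<phi> y"
    and image_mult: "\<phi> (x * y) = \<phi> x \<otimes> \<phi> y"
    and image_one: "\<phi> 1 = \<one>"
begin

lemma image_zero: "\<phi> 0 = \<zero>"
proof -
  have "\<phi> 0 \<oplus> \<phi> 0 = \<phi> 0" using image_add[of 0 0] by simp
  then show ?thesis by simp
qed

lemma image_uminus: "\<phi> (- x) = \<ominus> \<phi> x"
proof -
  have "\<phi> (- x) \<oplus> \<phi> x = \<zero>" using image_add[of "-x" x] by (simp add: image_zero)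
  then show ?thesis by (simp add: minus_equality)
qed

lemma image_minus: "\<phi> (x - y) = \<phi> x \<ominus> \<phi> y"
  using image_add[of x "-y"] by (simp add: image_uminus minus_eq)

lemma image_power: "\<phi> (x ^ n) = \<phi> x [^] n"
  by (induction n) (simp_all add: image_one image_mult power_Suc2 del: power_Suc)

lemma image_commute: "\<phi> x \<otimes> \<phi> y = \<phi> y \<otimes> \<phi> x"
  by (simp flip: image_mult add: mult.commute)

lemma image_of_int: "\<phi> (of_int i) = [(i::int)] \<cdot> \<one>"
proof (induction i rule: int_induct[of _ 0])
  case base show ?case by (simp add: image_zero add_pow_def)
next
  case (step1 i)
  then show ?case by (simp add: image_add image_one add.int_pow_mult)
next
  case (step2 i)
  then show ?case by (simp add: image_minus image_one add.int_pow_diff minus_eq)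
qed

lemma image_zero_mult: "\<phi> x = \<zero> \<Longrightarrow> \<phi> (x * y) = \<zero>" "\<phi> y = \<zero> \<Longrightarrow> \<phi> (x * y) = \<zero>"
  by (simp_all add: image_mult)

lemma image_zero_dvd: "\<phi> x = \<zero> \<Longrightarrow> x dvd y \<Longrightarrow> \<phi> y = \<zero>"
  by (auto simp: image_zero_mult elim!: dvdE)

lemma image_zero_add: "\<phi> x = \<zero> \<Longrightarrow> \<phi> y = \<zero> \<Longrightarrow> \<phi> (x + y) = \<zero>"
  by (simp add: image_add)

text \<open>
  The preimage of the nilpotent elements. Because the domain is commutative it is a radical ideal,
  so nilpotence can be checked by ideal membership.
\<close>

abbreviation nil :: "'c \<Rightarrow> bool" where "nil x \<equiv> nilpotent_elem R (\<phi> x)"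

lemma nil_iff: "nil x \<longleftrightarrow> (\<exists>n. \<phi> (x ^ n) = \<zero>)"
  by (simp add: nilpotent_elem_def image_power)

lemma nil_mult_right: "nil x \<Longrightarrow> nil (x * y)"
  unfolding nil_iff by (auto simp: power_mult_distrib intro: image_zero_mult)

lemma nil_mult_left: "nil y \<Longrightarrow> nil (x * y)"
  using nil_mult_right[of y x] by (simp add: mult.commute)

lemma nil_zero: "nil 0"
  unfolding nil_iff by (rule exI[of _ 1]) (simp add: image_zero)

lemma nil_if_image_zero: "\<phi> x = \<zero> \<Longrightarrow> nil x"
  unfolding nil_iff by (rule exI[of _ 1]) simp

lemma nil_uminus: "nil x \<Longrightarrow> nil (- x)"
  using nil_mult_left[of x "-1"] by simp

text \<open>
  In the binomial expansion of \<open>(x + y) ^ (m + n)\<close> every term contains \<open>x ^ m\<close> or \<open>y ^ n\<close>.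
\<close>

lemma nil_add:
  assumes "nil x" "nil y"
  shows "nil (x + y)"
proof -
  obtain m n where m: "\<phi> (x ^ m) = \<zero>" and n: "\<phi> (y ^ n) = \<zero>"
    using assms unfolding nil_iff by blast
  have "\<phi> (of_nat ((m + n) choose k) * x ^ k * y ^ (m + n - k)) = \<zero>" if "k \<le> m + n" for k
  proof (cases "m \<le> k")
    case True
    then have "x ^ m dvd of_nat ((m + n) choose k) * x ^ k * y ^ (m + n - k)"
      by (simp add: le_imp_power_dvd)
    with m show ?thesis using image_zero_dvd by blast
  next
    case False
    then have "y ^ n dvd of_nat ((m + n) choose k) * x ^ k * y ^ (m + n - k)"
      by (simp add: le_imp_power_dvd)
    with n show ?thesis using image_zero_dvd by blast
  qed
  moreover have "\<phi> (sum f A) = \<zero>" if "finite A" "\<And>k. k \<in> A \<Longrightarrow> \<phi> (f k) = \<zero>" for f :: "nat \<Rightarrow> 'c" and A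
    using that by (induction A) (auto simp: image_zero image_add)
  ultimately have "\<phi> (\<Sum>k\<le>m + n. of_nat (m + n choose k) * x ^ k * y ^ (m + n - k)) = \<zero>"
    by (metis (no_types, lifting) atMost_iff finite_atMost)
  then have "\<phi> ((x + y) ^ (m + n)) = \<zero>"
    by (simp add: binomial_ring)
  then show ?thesis unfolding nil_iff by blast
qed

lemma nil_diff: "nil x \<Longrightarrow> nil y \<Longrightarrow> nil (x - y)"
  using nil_add[OF _ nil_uminus, of x y] by simp

lemma nil_power: "nil (x ^ n) \<Longrightarrow> nil x"
  unfolding nil_iff by (auto simp flip: power_mult)

lemma nil_dvd: "nil x \<Longrightarrow> x dvd y \<Longrightarrow> nil y"
  by (auto simp: nil_mult_right elim!: dvdE)

lemma nil_cancel_unit: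
  assumes "nil (x * y)" "\<phi> y \<in> Units R"
  shows "nil x"
proof -
  obtain n where n: "\<phi> ((x * y) ^ n) = \<zero>" using assms(1) nil_iff by blast
  have u: "\<phi> y [^] n \<in> Units R" using assms(2) by (rule Units_pow_closed)
  have "\<phi> (x ^ n) \<otimes> (\<phi> y [^] n) = \<zero>"
    using n by (simp add: power_mult_distrib image_mult image_power)
  then have "\<phi> (x ^ n) \<otimes> (\<phi> y [^] n) \<otimes> inv (\<phi> y [^] n) = \<zero>" using u by simp
  then have "\<phi> (x ^ n) = \<zero>" using u by (simp add: m_assoc Units_r_inv)
  then show ?thesis using nil_iff by blast
qed

lemma nil_idempotent_zero:
  assumes "nil x" "\<phi> (x * x - x) = \<zero>" shows "\<phi> x = \<zero>"
proof -
  have eq: "\<phi> (x * x) = \<phi> x"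
  proof -
    have "\<phi> (x * x) = \<phi> ((x * x - x) + x)" by simp
    also have "\<dots> = \<phi> x" using assms(2) by (simp only: image_add) simp
    finally show ?thesis .
  qed
  have "\<phi> (x ^ Suc n) = \<phi> x" for n
  proof (induction n)
    case (Suc n)
    have "\<phi> (x ^ Suc (Suc n)) = \<phi> x \<otimes> \<phi> (x ^ Suc n)" by (simp only: power_Suc[of x "Suc n"] image_mult)
    then show ?case using Suc eq by (simp only: image_mult)
  qed simp
  moreover obtain n where "\<phi> (x ^ n) = \<zero>" using assms(1) nil_iff by blast
  then have "\<phi> (x ^ Suc n) = \<zero>" by (simp add: image_mult)
  ultimately show ?thesis by metis
qed

text \<open>
  The evaluation homomorphism: an element that commutes with the image of \<open>\<phi>\<close> can be adjoined as
  the value of a polynomial variable. The last clause keeps track of what still commutes with the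
  larger image, which is what allows the construction to be iterated.
\<close>

lemma adjoin_commuting_element:
  assumes b: "b \<in> carrier R" and comm: "\<And>c. \<phi> c \<otimes> b = b \<otimes> \<phi> c"
  obtains \<psi> :: "'c poly \<Rightarrow> 'a" where "commutative_image R \<psi>" "\<And>c. \<psi> [:c:] = \<phi> c" "\<psi> [:0, 1:] = b"
    "\<And>d h. d \<in> carrier R \<Longrightarrow> (\<And>c. \<phi> c \<otimes> d = d \<otimes> \<phi> c) \<Longrightarrow> b \<otimes> d = d \<otimes> b \<Longrightarrow> \<psi> h \<otimes> d = d \<otimes> \<psi> h"
proof -
  define \<psi> where "\<psi> h = fold_coeffs (\<lambda>c y. \<phi> c \<oplus> b \<otimes> y) h \<zero>" for h
  have z: "\<psi> 0 = \<zero>" by (simp add: \<psi>_def)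
  have pC: "\<psi> (pCons c h) = \<phi> c \<oplus> b \<otimes> \<psi> h" for c h
    by (cases "c = 0 \<and> h = 0") (auto simp: \<psi>_def b image_zero)
  have cl: "\<psi> h \<in> carrier R" for h
    by (induction h) (auto simp: z pC b)
  have ad: "\<psi> (g + h) = \<psi> g \<oplus> \<psi> h" for g h
    by (induction g h rule: poly_induct2)
       (auto simp: z pC b cl image_add r_distr a_ac)
  have cm: "\<psi> h \<otimes> d = d \<otimes> \<psi> h"
    if "d \<in> carrier R" "\<And>c. \<phi> c \<otimes> d = d \<otimes> \<phi> c" "b \<otimes> d = d \<otimes> b" for d h
  proof (induction h)
    case 0 show ?case using that by (simp add: z)
  next
    case (pCons c h)
    have "b \<otimes> \<psi> h \<otimes> d = d \<otimes> (b \<otimes> \<psi> h)"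
      using that(1,3) b cl[of h] pCons.IH m_assoc[of b "\<psi> h" d] m_assoc[of b d "\<psi> h"] m_assoc[of d b "\<psi> h"]
      by simp
    then show ?case using that b cl by (simp add: pC l_distr r_distr)
  qed
  have sm: "\<psi> (Polynomial.smult c h) = \<phi> c \<otimes> \<psi> h" for c h
  proof (induction h)
    case 0 show ?case by (simp add: z)
  next
    case (pCons d h)
    have "b \<otimes> (\<phi> c \<otimes> \<psi> h) = \<phi> c \<otimes> (b \<otimes> \<psi> h)"
      using comm[of c] b cl[of h] m_assoc[of b "\<phi> c" "\<psi> h"] m_assoc[of "\<phi> c" b "\<psi> h"] by simp
    then show ?case using pCons b cl by (simp add: pC image_mult r_distr m_assoc)
  qed
  have mu: "\<psi> (g * h) = \<psi> g \<otimes> \<psi> h" for g h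
  proof (induction g)
    case 0 show ?case by (simp add: z cl)
  next
    case (pCons c g)
    then show ?case using b cl by (simp add: pC ad sm image_zero l_distr m_assoc)
  qed
  have "commutative_image R \<psi>"
    by unfold_locales (auto simp: cl ad mu one_pCons pC z b image_one)
  moreover have "\<psi> [:c:] = \<phi> c" for c by (simp add: pC z b)
  moreover have "\<psi> [:0, 1:] = b" by (simp add: pC z b image_zero image_one)
  ultimately show ?thesis using that cm by blast
qed

end

context ring begin

lemma integers_commutative_image: "commutative_image R (\<lambda>i::int. [i] \<cdot> \<one>)"
  by unfold_locales (simp_all add: add.int_pow_mult add_pow_ldistr_int add.int_pow_pow mult.commute)

lemma integer_commute: "a \<in> carrier R \<Longrightarrow> ([(i::int)] \<cdot> \<one>) \<otimes> a = a \<otimes> ([i] \<cdot> \<one>)"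
  by (simp add: add_pow_ldistr_int add_pow_rdistr_int)

lemma element_commutative_image:
  assumes "a \<in> carrier R"
  obtains \<phi> :: "int poly \<Rightarrow> 'a" and X where "commutative_image R \<phi>" "\<phi> X = a"
proof -
  interpret Z: commutative_image R "\<lambda>i::int. [i] \<cdot> \<one>" by (rule integers_commutative_image)
  show ?thesis
    by (rule Z.adjoin_commuting_element[OF assms integer_commute[OF assms]]) (rule that)
qed

lemma commuting_pair_commutative_image:
  assumes "a \<in> carrier R" "b \<in> carrier R" "a \<otimes> b = b \<otimes> a"
  obtains \<phi> :: "int poly poly \<Rightarrow> 'a" and X Y where "commutative_image R \<phi>" "\<phi> X = a" "\<phi> Y = b"
    "\<And>d h. d \<in> carrier R \<Longrightarrow> a \<otimes> d = d \<otimes> a \<Longrightarrow> b \<otimes> d = d \<otimes> b \<Longrightarrow> \<phi> h \<otimes> d = d \<otimes> \<phi> h"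
proof -
  interpret Z: commutative_image R "\<lambda>i::int. [i] \<cdot> \<one>" by (rule integers_commutative_image)
  show ?thesis
  proof (rule Z.adjoin_commuting_element[OF assms(1) integer_commute[OF assms(1)]])
    fix \<phi> :: "int poly \<Rightarrow> 'a"
    assume \<phi>: "commutative_image R \<phi>" "\<phi> [:0, 1:] = a"
      and c: "\<And>d h. d \<in> carrier R \<Longrightarrow> (\<And>i::int. ([i] \<cdot> \<one>) \<otimes> d = d \<otimes> ([i] \<cdot> \<one>))
        \<Longrightarrow> a \<otimes> d = d \<otimes> a \<Longrightarrow> \<phi> h \<otimes> d = d \<otimes> \<phi> h"
    have c1: "\<phi> h \<otimes> d = d \<otimes> \<phi> h" if "d \<in> carrier R" "a \<otimes> d = d \<otimes> a" for d h
      using c[OF that(1) integer_commute[OF that(1)] that(2)] .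
    interpret Za: commutative_image R \<phi> by (rule \<phi>)
    show ?thesis
    proof (rule Za.adjoin_commuting_element[OF assms(2) c1[OF assms(2,3)]])
      fix \<psi> :: "int poly poly \<Rightarrow> 'a"
      assume \<psi>: "commutative_image R \<psi>" "\<And>c. \<psi> [:c:] = \<phi> c" "\<psi> [:0, 1:] = b"
        and c2: "\<And>d h. d \<in> carrier R \<Longrightarrow> (\<And>c. \<phi> c \<otimes> d = d \<otimes> \<phi> c) \<Longrightarrow> b \<otimes> d = d \<otimes> b
          \<Longrightarrow> \<psi> h \<otimes> d = d \<otimes> \<psi> h"
      show ?thesis
      proof (rule that)
        show "\<psi> [:[:0, 1:]:] = a" using \<phi>(2) \<psi>(2) by simp
        fix d h assume d: "d \<in> carrier R" "a \<otimes> d = d \<otimes> a" "b \<otimes> d = d \<otimes> b"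
        show "\<psi> h \<otimes> d = d \<otimes> \<psi> h" by (rule c2[OF d(1) c1[OF d(1,2)] d(3)])
      qed (rule \<psi>)+
    qed
  qed
qed

lemma commuting_triple_commutative_image:
  assumes "a \<in> carrier R" "b \<in> carrier R" "c \<in> carrier R"
    "a \<otimes> b = b \<otimes> a" "a \<otimes> c = c \<otimes> a" "b \<otimes> c = c \<otimes> b"
  obtains \<phi> :: "int poly poly poly \<Rightarrow> 'a" and X Y Z
    where "commutative_image R \<phi>" "\<phi> X = a" "\<phi> Y = b" "\<phi> Z = c"
proof (rule commuting_pair_commutative_image[OF assms(1,2,4)])
  fix \<phi> :: "int poly poly \<Rightarrow> 'a" and X Y
  assume \<phi>: "commutative_image R \<phi>" "\<phi> X = a" "\<phi> Y = b"
    and *: "\<And>d h. d \<in> carrier R \<Longrightarrow> a \<otimes> d = d \<otimes> a \<Longrightarrow> b \<otimes> d = d \<otimes> b \<Longrightarrow> \<phi> h \<otimes> d = d \<otimes> \<phi> h"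
  note c = *[OF assms(3,5,6)]
  interpret Zab: commutative_image R \<phi> by (rule \<phi>)
  show ?thesis
  proof (rule Zab.adjoin_commuting_element[OF assms(3) c])
    fix \<psi> :: "int poly poly poly \<Rightarrow> 'a"
    assume \<psi>: "commutative_image R \<psi>" "\<And>h. \<psi> [:h:] = \<phi> h" "\<psi> [:0, 1:] = c"
    show ?thesis using that[of \<psi> "[:X:]" "[:Y:]" "[:0, 1:]"] \<phi> \<psi> by simp
  qed
qed

end

section \<open>Fifth powers and sums of two tripotents in a commutative image\<close>

text \<open>
  The ideals generated by powers of \<open>x\<close> and of \<open>1 - x\<close> are comaximal, and \<open>e\<close> is the resulting
  element that is 0 modulo the first and 1 modulo the second. If \<open>x * (1 - x)\<close> is nilpotent this
  lifts \<open>x\<close> to an idempotent. Newton's step \<open>e \<mapsto> 3 e\<^sup>2 - 2 e\<^sup>3\<close> for the equation \<open>e\<^sup>2 = e\<close> doubles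
  both exponents.
\<close>

lemma comaximal_powers_idempotent:
  fixes x :: "'c::comm_ring_1"
  obtains e where "x ^ n dvd e" "(1 - x) ^ n dvd 1 - e"
proof -
  \<comment> \<open>Powers of two suffice, since each Newton step doubles the exponent.\<close>
  have "\<exists>e. x ^ 2 ^ k dvd e \<and> (1 - x) ^ 2 ^ k dvd 1 - e" for k
  proof (induction k)
    case 0
    show ?case by (rule exI[of _ x]) simp
  next
    case (Suc k)
    then obtain e where e: "x ^ 2 ^ k dvd e" "(1 - x) ^ 2 ^ k dvd 1 - e" by blast
    have "x ^ 2 ^ Suc k dvd e ^ 2 * (3 - 2 * e)"
      using dvd_mult2[OF dvd_power_same[OF e(1), of 2], of "3 - 2 * e"]
      by (simp only: power_Suc2 power_mult)
    moreover have "(1 - x) ^ 2 ^ Suc k dvd (1 - e) ^ 2 * (1 + 2 * e)"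
      using dvd_mult2[OF dvd_power_same[OF e(2), of 2], of "1 + 2 * e"]
      by (simp only: power_Suc2 power_mult)
    moreover have "(1 - e) ^ 2 * (1 + 2 * e) = 1 - e ^ 2 * (3 - 2 * e)"
      by (simp add: algebra_simps power2_eq_square)
    ultimately show ?case by metis
  qed
  then obtain e where "x ^ 2 ^ n dvd e" "(1 - x) ^ 2 ^ n dvd 1 - e" by blast
  moreover have "n \<le> 2 ^ n" by (simp add: less_imp_le)
  ultimately show ?thesis using that le_imp_power_dvd dvd_trans by metis
qed

context commutative_image begin

lemma nil_120_30: "nil 120 \<Longrightarrow> nil 30"
  using nil_mult_right[of 120 225] nil_power[of 30 3] by simp

text \<open>
  The first polynomial is \<open>x (x\<^sup>2 - 1) (x\<^sup>2 - 4)\<close>, which vanishes on all sums of two elements of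
  \<open>{0, 1, -1}\<close>. For the second, \<open>(p + q)^5\<close> differs from \<open>p + q\<close> by \<open>15 p q (p + q)\<close> modulo
  \<open>p^3 - p\<close> and \<open>q^3 - q\<close>; this need not be a multiple of 30, but modulo the same elements its
  square is.
\<close>

lemma tripotent_sum:
  assumes "nil (p ^ 3 - p)" "nil (q ^ 3 - q)" "nil w" and x: "x = p + q + w"
  shows "nil (x ^ 5 - 5 * x ^ 3 + 4 * x)" and "nil 30 \<Longrightarrow> nil (x ^ 5 - x)"
proof -
  let ?s = "p + q"
  have xs: "nil (x - ?s)" using assms by simp
  have "?s ^ 5 - 5 * ?s ^ 3 + 4 * ?s = (p ^ 3 - p) * (p\<^sup>2 - 4 + 5 * p * q + 10 * q\<^sup>2)
      + (q ^ 3 - q) * (q\<^sup>2 - 4 + 10 * p\<^sup>2 + 5 * p * q)"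
    by (simp add: algebra_simps eval_nat_numeral)
  then have "nil (?s ^ 5 - 5 * ?s ^ 3 + 4 * ?s)"
    using assms by (simp add: nil_add nil_mult_right)
  moreover have "x ^ 5 - 5 * x ^ 3 + 4 * x = (?s ^ 5 - 5 * ?s ^ 3 + 4 * ?s) + (x - ?s) *
      (x ^ 4 + x ^ 3 * ?s + x\<^sup>2 * ?s\<^sup>2 + x * ?s ^ 3 + ?s ^ 4 - 5 * (x\<^sup>2 + x * ?s + ?s\<^sup>2) + 4)"
    unfolding x
    by (simp add: algebra_simps eval_nat_numeral)
  ultimately show "nil (x ^ 5 - 5 * x ^ 3 + 4 * x)"
    using xs by (metis nil_add nil_mult_right)
  assume 30: "nil 30"
  have "?s ^ 5 - ?s = 15 * p * q * ?s + (p ^ 3 - p) * (p\<^sup>2 + 1 + 5 * p * q + 10 * q\<^sup>2)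
      + (q ^ 3 - q) * (q\<^sup>2 + 1 + 10 * p\<^sup>2 + 5 * p * q)"
    by (simp add: algebra_simps eval_nat_numeral)
  moreover have "(15 * p * q * ?s)\<^sup>2 = 30 * (15 * (p ^ 3 * q ^ 3 + p\<^sup>2 * q\<^sup>2))
      + (p ^ 3 - p) * (225 * p * q\<^sup>2) + (q ^ 3 - q) * (225 * p\<^sup>2 * q)"
    by (simp add: algebra_simps eval_nat_numeral)
  then have "nil ((15 * p * q * ?s)\<^sup>2)"
    using assms 30 by (simp only: nil_add nil_mult_right)
  then have "nil (15 * p * q * ?s)" by (rule nil_power)
  ultimately have "nil (?s ^ 5 - ?s)"
    using assms by (simp add: nil_add nil_mult_right)
  moreover have "x ^ 5 - x = (?s ^ 5 - ?s) + (x - ?s) *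
      (x ^ 4 + x ^ 3 * ?s + x\<^sup>2 * ?s\<^sup>2 + x * ?s ^ 3 + ?s ^ 4 - 1)"
    unfolding x
    by (simp add: algebra_simps eval_nat_numeral)
  ultimately show "nil (x ^ 5 - x)"
    using xs by (metis nil_add nil_mult_right)
qed

text \<open>
  All lifts are taken with a common exponent \<open>n\<close> that kills the \<open>n\<close>-th powers of the finitely many
  nilpotent obstructions. Since \<open>E i\<close> is a multiple of \<open>e i ^ n\<close>, and \<open>1 - E i\<close> of
  \<open>(1 - e i) ^ n\<close>, idempotence and orthogonality then hold exactly.
\<close>

lemma lift_orthogonal_idempotents:
  fixes e :: "'i \<Rightarrow> 'c"
  assumes fin: "finite I"
    and idem: "\<And>i. i \<in> I \<Longrightarrow> nil (e i * (1 - e i))"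
    and orth: "\<And>i j. i \<in> I \<Longrightarrow> j \<in> I \<Longrightarrow> i \<noteq> j \<Longrightarrow> nil (e i * e j)"
  obtains E where "\<And>i. i \<in> I \<Longrightarrow> \<phi> (E i * (1 - E i)) = \<zero>"
    "\<And>i j. i \<in> I \<Longrightarrow> j \<in> I \<Longrightarrow> i \<noteq> j \<Longrightarrow> \<phi> (E i * E j) = \<zero>"
    "\<And>i. i \<in> I \<Longrightarrow> nil (e i - E i)"
proof -
  define S where "S = (\<lambda>i. e i * (1 - e i)) ` I \<union> (\<lambda>(i, j). e i * e j) ` {(i, j) \<in> I \<times> I. i \<noteq> j}"
  have "finite S" using fin unfolding S_def
    by (intro finite_UnI finite_imageI) (auto intro: finite_subset[OF _ finite_cartesian_product[OF fin fin]])
  moreover have "\<forall>s\<in>S. nil s" unfolding S_def using idem orth by auto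
  ultimately have "\<exists>n>0. \<forall>s\<in>S. \<phi> (s ^ n) = \<zero>"
  proof (induction S)
    case empty show ?case by auto
  next
    case (insert s S)
    then obtain n where n: "n > 0" "\<And>t. t \<in> S \<Longrightarrow> \<phi> (t ^ n) = \<zero>" by auto
    from insert.prems obtain m where m: "\<phi> (s ^ m) = \<zero>" by (auto simp: nil_iff)
    have "\<phi> (s ^ (n + m)) = \<zero>" using m by (simp add: power_add image_zero_mult)
    moreover have "\<phi> (t ^ (n + m)) = \<zero>" if "t \<in> S" for t
      using n that by (simp add: power_add image_zero_mult)
    ultimately show ?case using n(1) by (intro exI[of _ "n + m"]) auto
  qed
  then obtain n where "n > 0" and n: "\<And>s. s \<in> S \<Longrightarrow> \<phi> (s ^ n) = \<zero>" by auto
  have "\<exists>E. \<forall>i. e i ^ n dvd E i \<and> (1 - e i) ^ n dvd 1 - E i"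
    by (intro choice allI) (metis comaximal_powers_idempotent)
  then obtain E where E: "\<And>i. e i ^ n dvd E i" "\<And>i. (1 - e i) ^ n dvd 1 - E i" by auto
  show ?thesis
  proof (rule that)
    fix i assume i: "i \<in> I"
    have "(e i * (1 - e i)) ^ n dvd E i * (1 - E i)"
      unfolding power_mult_distrib by (intro mult_dvd_mono E)
    moreover have "\<phi> ((e i * (1 - e i)) ^ n) = \<zero>" using i by (intro n) (auto simp: S_def)
    ultimately show "\<phi> (E i * (1 - E i)) = \<zero>" using image_zero_dvd by blast
    \<comment> \<open>The difference lies in the ideal generated by \<open>e i * (1 - e i)\<close>.\<close>
    have "e i * (1 - E i) - E i * (1 - e i) = e i - E i" by (simp add: algebra_simps)
    moreover have "e i dvd E i" "1 - e i dvd 1 - E i"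
      using E[of i] \<open>n > 0\<close> by (meson dvd_power dvd_trans)+
    then have "e i * (1 - e i) dvd e i * (1 - E i) - E i * (1 - e i)"
      by (metis dvd_diff dvd_refl mult_dvd_mono)
    ultimately show "nil (e i - E i)" using nil_dvd[OF idem[OF i]] by metis
  next
    fix i j assume ij: "i \<in> I" "j \<in> I" "i \<noteq> j"
    have "(e i * e j) ^ n dvd E i * E j"
      unfolding power_mult_distrib by (intro mult_dvd_mono E)
    moreover have "\<phi> ((e i * e j) ^ n) = \<zero>" using ij by (intro n) (auto simp: S_def)
    ultimately show "\<phi> (E i * E j) = \<zero>" using image_zero_dvd by blast
  qed
qed

text \<open>
  With orthogonal idempotents \<open>a\<close> and \<open>b\<close>, the difference takes only the values \<open>0, 1, -1\<close>.
\<close>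

lemma image_tripotent_difference:
  assumes A: "\<phi> (a * (1 - a)) = \<zero>" and B: "\<phi> (b * (1 - b)) = \<zero>" and AB: "\<phi> (a * b) = \<zero>"
  shows "tripotent_elem R (\<phi> (a - b))"
proof -
  have "(a - b) ^ 3 = (a - b) + (a * (1 - a) * (- a - 1) + b * (1 - b) * (b + 1) + a * b * (3 * b - 3 * a))"
    by (simp add: algebra_simps eval_nat_numeral)
  moreover have "\<phi> (a * (1 - a) * (- a - 1) + b * (1 - b) * (b + 1) + a * b * (3 * b - 3 * a)) = \<zero>"
    using assms by (simp only: image_zero_add image_zero_mult(1))
  ultimately have "\<phi> ((a - b) ^ 3) = \<phi> (a - b)" by (simp only: image_add) simp
  then show ?thesis by (simp add: tripotent_elem_def image_power)
qed

lemma image_idempotent_sum: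
  assumes "\<phi> (a * (1 - a)) = \<zero>" "\<phi> (b * (1 - b)) = \<zero>" "\<phi> (a * b) = \<zero>"
  shows "\<phi> ((a + b) * (1 - (a + b))) = \<zero>"
proof -
  have "(a + b) * (1 - (a + b)) = a * (1 - a) + b * (1 - b) + a * b * (- 2)"
    by (simp add: algebra_simps)
  then show ?thesis using assms by (metis image_zero_add image_zero_mult(1))
qed

text \<open>
  Modulo 30 the integers \<open>15, 10, 6\<close> are the orthogonal idempotents for the primes \<open>2, 3, 5\<close>, so an
  element given by a component at each prime can be multiplied component by component.
\<close>

lemma nil_crt:
  assumes "nil 30" "nil (15 * (a * a'))" "nil (10 * (b * b'))" "nil (6 * (c * c'))"
  shows "nil ((15 * a + 10 * b + 6 * c) * (15 * a' + 10 * b' + 6 * c'))"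
proof -
  have "(15 * a + 10 * b + 6 * c) * (15 * a' + 10 * b' + 6 * c') =
    15 * (a * a') * 15 + 10 * (b * b') * 10 + 6 * (c * c') * 6 +
    30 * (5 * a * b' + 5 * b * a' + 3 * a * c' + 3 * c * a' + 2 * b * c' + 2 * c * b')"
    by (simp add: algebra_simps)
  then show ?thesis using assms by (simp only: nil_add nil_mult_right)
qed

text \<open>
  Modulo nilpotents \<open>x\<close> takes values in \<open>F\<^sub>2\<close>, \<open>F\<^sub>3\<close> and \<open>F\<^sub>5\<close>. For \<open>c\<close> among
  \<open>1, -1, 2, -2\<close> the element \<open>e c\<close> is the indicator of the value \<open>c\<close>, where 1 is represented by
  \<open>c = 1\<close> in \<open>F\<^sub>2\<close>, and \<open>1, -1\<close> by \<open>c = 1, -1\<close> in \<open>F\<^sub>3\<close>, so that each nonzero value is represented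
  once. Then \<open>x\<close> is the sum of all \<open>c * e c\<close> modulo nilpotents, and the multiples by 2 and -2 are
  shared between the two tripotents.
\<close>

lemma sum_of_two_tripotents:
  assumes fifth: "\<And>y. nil (y ^ 5 - y)"
  obtains p q where "tripotent_elem R (\<phi> p)" "tripotent_elem R (\<phi> q)" "nil (x - (p + q))"
proof -
  have n30: "nil 30" using fifth[of 2] by simp
  \<comment> \<open>\<open>(x (x - 1))^4\<close> equals \<open>x^3 (x^5 - x)\<close> modulo 2, because \<open>(x - 1)^4 = x^4 - 1\<close> there; multiplying
    by 15 turns a multiple of 2 into a multiple of 30.\<close>
  have two: "nil (15 * (x * (1 - x)))"
  proof (rule nil_power)
    have "(15 * (x * (1 - x))) ^ 4 = (x ^ 5 - x) * (15 ^ 4 * x ^ 3)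
        + 30 * (15 ^ 3 * x ^ 4 * (- 2 * x ^ 3 + 3 * x\<^sup>2 - 2 * x + 1))"
      by (simp add: algebra_simps eval_nat_numeral)
    then show "nil ((15 * (x * (1 - x))) ^ 4)"
      using fifth n30 by (simp only: nil_add nil_mult_right)
  qed
  \<comment> \<open>The equation \<open>x^5 = x\<close> alone permits square roots of -1 in characteristic 3. They are excluded by
    the same equation for \<open>x + 1\<close>, since \<open>1 + i\<close> has order 8 in \<open>F\<^sub>9\<close>.\<close>
  have three: "nil (10 * (x ^ 3 - x))"
  proof -
    have "10 * (x ^ 3 - x) = (x ^ 5 - x) * (20 + 10 * (x + 1)) + ((x + 1) ^ 5 - (x + 1)) * (- 10 * (x + 1))
        + 30 * (x ^ 5 + 5 * x ^ 4 + 7 * x ^ 3 + 5 * x\<^sup>2 + 2 * x)"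
      by (simp add: algebra_simps eval_nat_numeral)
    then show ?thesis using fifth n30 by (simp only: nil_add nil_mult_right)
  qed
  \<comment> \<open>Lagrange interpolation in \<open>F\<^sub>2\<close>, \<open>F\<^sub>3\<close> and \<open>F\<^sub>5\<close>.\<close>
  define b2 :: "int \<Rightarrow> 'c" where "b2 c = (if c = 1 then x else 0)" for c
  define b3 :: "int \<Rightarrow> 'c" where "b3 c = (if \<bar>c\<bar> = 1 then - (x\<^sup>2 + of_int c * x) else 0)" for c
  define b5 :: "int \<Rightarrow> 'c" where "b5 c = 1 - (x - of_int c) ^ 4" for c
  define e where "e c = 15 * b2 c + 10 * b3 c + 6 * b5 c" for c
  let ?I = "{1, -1, 2, -2} :: int set"
  have b5: "nil (b5 c * (x - of_int c))" for c
  proof -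
    have "b5 c * (x - of_int c) = - ((x - of_int c) ^ 5 - (x - of_int c))"
      by (simp add: b5_def algebra_simps eval_nat_numeral)
    then show ?thesis using fifth nil_uminus by metis
  qed
  have idem: "nil (e c * (1 - e c))" if "c \<in> ?I" for c
  proof -
    have 2: "nil (15 * (b2 c * (1 - b2 c)))" using two by (simp add: b2_def nil_zero)
    have 3: "nil (10 * (b3 c * (1 - b3 c)))"
    proof (cases "\<bar>c\<bar> = 1")
      case True
      then have "c = 1 \<or> c = -1" by arith
      then have "10 * (b3 c * (1 - b3 c)) = 10 * (x ^ 3 - x) * (- (x - of_int c)) + 30 * (- of_int c * x\<^sup>2 * (x + of_int c))"
        by (auto simp: b3_def algebra_simps eval_nat_numeral)
      then show ?thesis using three n30 by (simp only: nil_add nil_mult_right)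
    qed (simp add: b3_def nil_zero)
    have "6 * (b5 c * (1 - b5 c)) = b5 c * (x - of_int c) * (6 * (x - of_int c) ^ 3)"
      by (simp add: b5_def algebra_simps eval_nat_numeral)
    then have 5: "nil (6 * (b5 c * (1 - b5 c)))" using b5 by (metis nil_mult_right)
    have "1 - e c = 15 * (1 - b2 c) + 10 * (1 - b3 c) + 6 * (1 - b5 c) + 30 * (- 1)"
      by (simp add: e_def)
    then have "e c * (1 - e c) = e c * (15 * (1 - b2 c) + 10 * (1 - b3 c) + 6 * (1 - b5 c)) + 30 * (- e c)"
      by (simp add: algebra_simps)
    with nil_crt[OF n30 2 3 5] n30 show ?thesis
      unfolding e_def[symmetric] by (simp only: nil_add nil_mult_right)
  qed
  have orth: "nil (e c * e d)" if cd: "c \<in> ?I" "d \<in> ?I" "c \<noteq> d" for c d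
  proof -
    have 2: "nil (15 * (b2 c * b2 d))" using cd by (auto simp add: b2_def nil_zero)
    have 3: "nil (10 * (b3 c * b3 d))"
    proof (cases "\<bar>c\<bar> = 1 \<and> \<bar>d\<bar> = 1")
      case True
      with cd have "c = 1 \<and> d = -1 \<or> c = -1 \<and> d = 1" by auto
      then have "10 * (b3 c * b3 d) = 10 * (x ^ 3 - x) * x"
        by (auto simp: b3_def algebra_simps eval_nat_numeral)
      then show ?thesis using three by (simp only: nil_mult_right)
    qed (auto simp add: b3_def nil_zero)
    \<comment> \<open>The values \<open>c\<close> and \<open>d\<close> differ modulo 5, so \<open>c - d\<close> can be cancelled: its inverse modulo 5 is
      its cube.\<close>
    have "6 * (b5 c * b5 d) * of_int (c - d) =
        b5 d * (x - of_int d) * (6 * b5 c) + b5 c * (x - of_int c) * (- 6 * b5 d)"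
      by (simp add: algebra_simps)
    then have *: "nil (6 * (b5 c * b5 d) * of_int (c - d))"
      using b5 by (simp only: nil_add nil_mult_right)
    have "5 dvd (c - d) * (c - d) ^ 3 - 1" using cd by auto
    then obtain k m where "(c - d) * k = 1 + 5 * m" by (metis dvdE diff_add_cancel add.commute)
    then have "of_int (c - d) * of_int k = (1 + 5 * of_int m :: 'c)"
      by (metis of_int_add of_int_mult of_int_1 of_int_numeral)
    then have "6 * (b5 c * b5 d) * of_int (c - d) * of_int k = 6 * (b5 c * b5 d) * (1 + 5 * of_int m)"
      by (simp add: mult.assoc)
    then have "6 * (b5 c * b5 d) = 6 * (b5 c * b5 d) * of_int (c - d) * of_int k + 30 * (- b5 c * b5 d * of_int m)"
      by (simp add: algebra_simps)
    with * n30 have 5: "nil (6 * (b5 c * b5 d))"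
      by (metis nil_add nil_mult_right)
    show ?thesis unfolding e_def by (rule nil_crt[OF n30 2 3 5])
  qed
  obtain E where E: "\<And>c. c \<in> ?I \<Longrightarrow> \<phi> (E c * (1 - E c)) = \<zero>"
    "\<And>c d. c \<in> ?I \<Longrightarrow> d \<in> ?I \<Longrightarrow> c \<noteq> d \<Longrightarrow> \<phi> (E c * E d) = \<zero>"
    "\<And>c. c \<in> ?I \<Longrightarrow> nil (e c - E c)"
    using lift_orthogonal_idempotents[of ?I e] idem orth by blast
  \<comment> \<open>The weights \<open>1, -1, 2, -2\<close> are the sums of \<open>1, -1, 1, -1\<close> and \<open>0, 0, 1, -1\<close>.\<close>
  define p where "p = (E 1 + E 2) - (E (-1) + E (-2))"
  define q where "q = E 2 - E (-2)"
  have orthsum: "\<phi> ((E 1 + E 2) * (E (-1) + E (-2))) = \<zero>"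
  proof -
    have "(E 1 + E 2) * (E (-1) + E (-2)) = E 1 * E (-1) + E 1 * E (-2) + E 2 * E (-1) + E 2 * E (-2)"
      by (simp add: algebra_simps)
    then show ?thesis using E(2) by (simp add: image_zero_add)
  qed
  have "tripotent_elem R (\<phi> p)" unfolding p_def
    by (intro image_tripotent_difference image_idempotent_sum E orthsum) auto
  moreover have "tripotent_elem R (\<phi> q)" unfolding q_def
    by (intro image_tripotent_difference E) auto
  moreover have "nil (x - (p + q))"
  proof -
    have "x - (e 1 - e (-1) + 2 * (e 2 - e (-2))) = 30 * (- 8 * x ^ 3 - 27 * x)"
      by (simp add: e_def b2_def b3_def b5_def algebra_simps eval_nat_numeral)
    then have "nil (x - (e 1 - e (-1) + 2 * (e 2 - e (-2))))"
      using n30 by (simp only: nil_mult_right)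
    moreover have "nil (e 1 - E 1)" "nil (e (-1) - E (-1))" "nil (e 2 - E 2)" "nil (e (-2) - E (-2))"
      by (auto intro: E)
    moreover have "x - (p + q) = x - (e 1 - e (-1) + 2 * (e 2 - e (-2))) + (e 1 - E 1) + (e (-1) - E (-1)) * (- 1)
        + (e 2 - E 2) * 2 + (e (-2) - E (-2)) * (- 2)"
      by (simp add: p_def q_def algebra_simps)
    ultimately show ?thesis by (simp only: nil_add nil_mult_right)
  qed
  ultimately show ?thesis using that by blast
qed

end

section \<open>Consequences of the nilpotence of fifth power differences\<close>

context ring begin

text \<open>
  The summands of a Zhou nil-clean decomposition become three variables of a polynomial ring.
\<close>

lemma zhou_nil_clean_element_image:
  assumes "zhou_nil_clean R" "a \<in> carrier R"
  obtains \<phi> :: "int poly poly poly \<Rightarrow> 'a" and p q w where "commutative_image R \<phi>"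
    "nilpotent_elem R (\<phi> (p ^ 3 - p))" "nilpotent_elem R (\<phi> (q ^ 3 - q))" "nilpotent_elem R (\<phi> w)" "\<phi> (p + q + w) = a"
proof -
  obtain p q w where *: "tripotent_elem R p" "tripotent_elem R q" "nilpotent_elem R w"
      "p \<otimes> q = q \<otimes> p" "p \<otimes> w = w \<otimes> p" "q \<otimes> w = w \<otimes> q" "a = p \<oplus> q \<oplus> w"
    using assms unfolding zhou_nil_clean_def by blast
  then have "p \<in> carrier R" "q \<in> carrier R" "w \<in> carrier R"
    by (auto simp: tripotent_elem_def nilpotent_elem_def)
  then show ?thesis
  proof (rule commuting_triple_commutative_image[OF _ _ _ *(4-6)])
    fix \<phi> :: "int poly poly poly \<Rightarrow> 'a" and X Y Z
    assume \<phi>: "commutative_image R \<phi>" and XYZ: "\<phi> X = p" "\<phi> Y = q" "\<phi> Z = w"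
    interpret commutative_image R \<phi> by (rule \<phi>)
    have "\<phi> (X ^ 3 - X) = \<zero>" "\<phi> (Y ^ 3 - Y) = \<zero>"
      using * by (simp_all add: image_minus image_power XYZ tripotent_elem_def r_neg minus_eq)
    then have "nil (X ^ 3 - X)" "nil (Y ^ 3 - Y)" by - (rule nil_if_image_zero, assumption)+
    moreover have "nil Z" "\<phi> (X + Y + Z) = a" using * by (simp_all add: XYZ image_add)
    ultimately show ?thesis by (rule that[OF \<phi>])
  qed
qed

lemma zhou_nil_clean_fifth_power:
  assumes "zhou_nil_clean R" "a \<in> carrier R"
  shows "nilpotent_elem R (a [^] (5::nat) \<ominus> a)"
proof -
  \<comment> \<open>A decomposition of \<open>3\<close> shows that \<open>3 (3\<^sup>2 - 1) (3\<^sup>2 - 4) = 120\<close> is nilpotent. It lives in a different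
    polynomial image than that of \<open>a\<close>, so the result is stated in \<open>R\<close>.\<close>
  have "nilpotent_elem R ([(30::int)] \<cdot> \<one>)"
  proof (rule zhou_nil_clean_element_image[OF assms(1)])
    show "[(3::int)] \<cdot> \<one> \<in> carrier R" by simp
    fix \<phi> :: "int poly poly poly \<Rightarrow> 'a" and p q w
    assume \<phi>: "commutative_image R \<phi>"
      and pqw: "nilpotent_elem R (\<phi> (p ^ 3 - p))" "nilpotent_elem R (\<phi> (q ^ 3 - q))" "nilpotent_elem R (\<phi> w)"
      and s: "\<phi> (p + q + w) = [(3::int)] \<cdot> \<one>"
    interpret commutative_image R \<phi> by (rule \<phi>)
    define x where x: "x = p + q + w"
    have "\<phi> x = \<phi> 3" using s image_of_int[of 3] by (simp add: x)
    then have "\<phi> (x ^ 5 - 5 * x ^ 3 + 4 * x) = \<phi> (3 ^ 5 - 5 * 3 ^ 3 + 4 * 3)"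
      by (simp only: image_add image_minus image_mult image_power)
    also have "3 ^ 5 - 5 * 3 ^ 3 + 4 * 3 = (120 :: int poly poly poly)" by simp
    finally have "nil 120" using tripotent_sum(1)[OF pqw x] by simp
    then have "nil 30" by (rule nil_120_30)
    then show ?thesis using image_of_int[of 30] by simp
  qed
  then show ?thesis
  proof (rule_tac zhou_nil_clean_element_image[OF assms])
    fix \<phi> :: "int poly poly poly \<Rightarrow> 'a" and p q w
    assume n30: "nilpotent_elem R ([(30::int)] \<cdot> \<one>)"
      and \<phi>: "commutative_image R \<phi>"
      and pqw: "nilpotent_elem R (\<phi> (p ^ 3 - p))" "nilpotent_elem R (\<phi> (q ^ 3 - q))" "nilpotent_elem R (\<phi> w)"
      and s: "\<phi> (p + q + w) = a"
    interpret commutative_image R \<phi> by (rule \<phi>)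
    have "nil 30" using n30 image_of_int[of 30] by simp
    from tripotent_sum(2)[OF pqw refl this] show ?thesis
      by (simp only: image_minus image_power s)
  qed
qed

lemma fifth_power_kosan_ring:
  assumes "\<And>a. a \<in> carrier R \<Longrightarrow> nilpotent_elem R (a [^] (5::nat) \<ominus> a)"
  shows "kosan_ring R"
  unfolding kosan_ring_def
proof
  fix u assume u: "u \<in> Units R"
  obtain \<phi> :: "int poly \<Rightarrow> 'a" and X where \<phi>: "commutative_image R \<phi>" and X: "\<phi> X = u"
    by (rule element_commutative_image[OF Units_closed[OF u]])
  interpret commutative_image R \<phi> by (rule \<phi>)
  have fac: "(X ^ 4 - 1) * X = X ^ 5 - X" by (simp add: algebra_simps eval_nat_numeral)
  have "nil (X ^ 5 - X)" using assms[OF Units_closed[OF u]] by (simp add: image_minus image_power X)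
  then have "nil ((X ^ 4 - 1) * X)" unfolding fac .
  then have "nil (X ^ 4 - 1)" by (rule nil_cancel_unit) (simp add: X u)
  then show "unipotent_elem R (u [^] (4::nat))"
    using Units_closed[OF u] by (simp add: unipotent_elem_def image_minus image_power image_one X)
qed

text \<open>
  The element \<open>x = a^4\<close> is idempotent modulo nilpotents. An idempotent divisible by \<open>x\<close> whose
  complement is divisible by \<open>1 - x\<close> lies in \<open>a R\<close>, and its complement in \<open>(1 - a) R\<close>.
\<close>

lemma fifth_power_exchange_ring:
  assumes "\<And>a. a \<in> carrier R \<Longrightarrow> nilpotent_elem R (a [^] (5::nat) \<ominus> a)"
  shows "exchange_ring R"
  unfolding exchange_ring_def
proof
  fix a assume a: "a \<in> carrier R"
  obtain \<phi> :: "int poly \<Rightarrow> 'a" and X where \<phi>: "commutative_image R \<phi>" and X: "\<phi> X = a"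
    by (rule element_commutative_image[OF a])
  interpret commutative_image R \<phi> by (rule \<phi>)
  have "nil (X ^ 5 - X)" using assms[OF a] by (simp add: image_minus image_power X)
  then obtain n where n: "\<phi> ((X ^ 5 - X) ^ n) = \<zero>" by (auto simp: nil_iff)
  \<comment> \<open>The exponent is \<open>Suc n\<close> rather than \<open>n\<close> because \<open>e\<close> has to be a multiple of \<open>X\<close> even if \<open>n = 0\<close>.\<close>
  obtain e where e: "(X ^ 4) ^ Suc n dvd e" "(1 - X ^ 4) ^ Suc n dvd 1 - e"
    by (rule comaximal_powers_idempotent)
  have "(X ^ 5 - X) ^ n dvd (X ^ 4 * (1 - X ^ 4)) ^ Suc n"
  proof -
    have "X ^ 5 - X dvd X ^ 4 * (1 - X ^ 4)"
      by (rule dvdI[of _ _ "- (X ^ 3)"]) (simp add: algebra_simps eval_nat_numeral)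
    then show ?thesis by (rule dvd_power_le) simp
  qed
  also have "\<dots> dvd e * (1 - e)" unfolding power_mult_distrib by (intro mult_dvd_mono e)
  finally have "\<phi> (e * (1 - e)) = \<zero>" using n image_zero_dvd by blast
  moreover have "e = e * e + e * (1 - e)" by (simp add: algebra_simps)
  ultimately have "\<phi> e = \<phi> e \<otimes> \<phi> e"
    by (metis image_add image_closed image_mult m_closed r_zero)
  then have "idempotent_elem R (\<phi> e)" by (simp add: idempotent_elem_def)
  moreover have "X dvd e"
  proof -
    have "X dvd X ^ 4" by (rule dvd_power) simp
    also have "X ^ 4 dvd (X ^ 4) ^ Suc n" by (rule dvd_power) simp
    finally show ?thesis using e(1) by (rule dvd_trans)
  qed
  then obtain r where r: "e = X * r" by (auto elim: dvdE)
  then have "\<phi> e = a \<otimes> \<phi> r" by (simp add: image_mult X)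
  moreover have "1 - X dvd 1 - X ^ 4"
    by (rule dvdI[of _ _ "1 + X + X\<^sup>2 + X ^ 3"]) (simp add: algebra_simps eval_nat_numeral)
  then have "1 - X dvd 1 - e"
  proof -
    note \<open>1 - X dvd 1 - X ^ 4\<close>
    also have "1 - X ^ 4 dvd (1 - X ^ 4) ^ Suc n" by (rule dvd_power) simp
    finally show ?thesis using e(2) by (rule dvd_trans)
  qed
  then obtain s where s: "1 - e = (1 - X) * s" by (auto elim: dvdE)
  then have "\<phi> (1 - e) = \<phi> ((1 - X) * s)" by simp
  then have "\<one> \<ominus> \<phi> e = (\<one> \<ominus> a) \<otimes> \<phi> s" by (simp add: image_mult image_minus image_one X)
  ultimately show "\<exists>e. idempotent_elem R e \<and> (\<exists>r\<in>carrier R. e = a \<otimes> r) \<and>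
      (\<exists>s\<in>carrier R. \<one> \<ominus> e = (\<one> \<ominus> a) \<otimes> s)"
    by blast
qed

lemma fifth_power_zhou_nil_clean:
  assumes fifth: "\<And>a. a \<in> carrier R \<Longrightarrow> nilpotent_elem R (a [^] (5::nat) \<ominus> a)"
  shows "zhou_nil_clean R"
  unfolding zhou_nil_clean_def
proof
  fix a assume a: "a \<in> carrier R"
  obtain \<phi> :: "int poly \<Rightarrow> 'a" and X where \<phi>: "commutative_image R \<phi>" and X: "\<phi> X = a"
    by (rule element_commutative_image[OF a])
  interpret commutative_image R \<phi> by (rule \<phi>)
  have "nil (y ^ 5 - y)" for y using fifth[of "\<phi> y"] by (simp add: image_minus image_power)
  then obtain p q where pq: "tripotent_elem R (\<phi> p)" "tripotent_elem R (\<phi> q)" "nil (X - (p + q))"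
    by (rule sum_of_two_tripotents)
  have "a = \<phi> (p + q + (X - (p + q)))" by (simp add: X)
  then have "a = \<phi> p \<oplus> \<phi> q \<oplus> \<phi> (X - (p + q))" by (simp only: image_add)
  with pq show "\<exists>p q w. tripotent_elem R p \<and> tripotent_elem R q \<and> nilpotent_elem R w \<and>
      p \<otimes> q = q \<otimes> p \<and> p \<otimes> w = w \<otimes> p \<and> q \<otimes> w = w \<otimes> q \<and> a = p \<oplus> q \<oplus> w"
    by (intro exI[of _ "\<phi> p"] exI[of _ "\<phi> q"] exI[of _ "\<phi> (X - (p + q))"] conjI image_commute)
qed

end

section \<open>The Jacobson radical of an exchange Kosan ring\<close>

context ring begin

text \<open>
  If \<open>v\<close> inverts \<open>1 - x r\<close>, then \<open>1 + r v x\<close> inverts \<open>1 - r x\<close>. In the geometric series this is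
  \<open>1 + r (1 + x r + x r x r + \<dots>) x = 1 + r x + r x r x + \<dots>\<close>.
\<close>

lemma Units_one_minus_mult_swap:
  assumes c [simp]: "x \<in> carrier R" "r \<in> carrier R" and u: "\<one> \<ominus> x \<otimes> r \<in> Units R"
  shows "\<one> \<ominus> r \<otimes> x \<in> Units R"
proof -
  define v where "v = inv (\<one> \<ominus> x \<otimes> r)"
  have c2 [simp]: "v \<in> carrier R" using u by (simp add: v_def)
  have "(\<one> \<ominus> x \<otimes> r) \<otimes> v = \<one>" using u by (simp add: v_def)
  then have "v \<ominus> x \<otimes> r \<otimes> v = \<one>" by (simp add: minus_eq l_distr l_minus)
  moreover have "v = (v \<ominus> x \<otimes> r \<otimes> v) \<oplus> x \<otimes> r \<otimes> v" using c c2 by algebra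
  ultimately have v1: "v = \<one> \<oplus> x \<otimes> r \<otimes> v" by simp
  have "v \<otimes> (\<one> \<ominus> x \<otimes> r) = \<one>" using u by (simp add: v_def)
  then have "v \<ominus> v \<otimes> x \<otimes> r = \<one>" by (simp add: minus_eq r_distr r_minus m_assoc)
  moreover have "v = (v \<ominus> v \<otimes> x \<otimes> r) \<oplus> v \<otimes> x \<otimes> r" using c c2 by algebra
  ultimately have v2: "v = \<one> \<oplus> v \<otimes> x \<otimes> r" by simp
  define t w where "t = r \<otimes> x" and "w = r \<otimes> v \<otimes> x"
  have [simp]: "t \<in> carrier R" "w \<in> carrier R" by (simp_all add: t_def w_def)
  have w1: "t \<oplus> t \<otimes> w = w"
    unfolding w_def by (subst (2) v1) (simp add: t_def l_distr r_distr m_assoc)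
  have w2: "t \<oplus> w \<otimes> t = w"
    unfolding w_def by (subst (2) v2) (simp add: t_def l_distr r_distr m_assoc)
  have "(\<one> \<ominus> t) \<otimes> (\<one> \<oplus> w) = \<one> \<oplus> (w \<ominus> (t \<oplus> t \<otimes> w))"
    by (simp add: minus_eq l_distr r_distr l_minus minus_add a_ac)
  then have 1: "(\<one> \<ominus> t) \<otimes> (\<one> \<oplus> w) = \<one>" by (simp add: w1 minus_eq r_neg)
  have "(\<one> \<oplus> w) \<otimes> (\<one> \<ominus> t) = \<one> \<oplus> (w \<ominus> (t \<oplus> w \<otimes> t))"
    by (simp add: minus_eq l_distr r_distr r_minus minus_add a_ac)
  then have "(\<one> \<oplus> w) \<otimes> (\<one> \<ominus> t) = \<one>" by (simp add: w2 minus_eq r_neg)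
  with 1 show ?thesis unfolding Units_def t_def[symmetric] by auto
qed

text \<open>
  The unit criterion is the form in which the radical is used; that it describes an ideal is the
  content of \<open>jacobson_radical_ideal\<close>.
\<close>

definition jacobson_radical :: "'a set" where
  "jacobson_radical = {x \<in> carrier R. \<forall>r\<in>carrier R. \<one> \<ominus> x \<otimes> r \<in> Units R}"

lemma jacobson_radical_closed: "x \<in> jacobson_radical \<Longrightarrow> x \<in> carrier R"
  by (simp add: jacobson_radical_def)

lemma jacobson_radical_unit: "x \<in> jacobson_radical \<Longrightarrow> r \<in> carrier R \<Longrightarrow> \<one> \<ominus> x \<otimes> r \<in> Units R"
  by (simp add: jacobson_radical_def)

lemma jacobson_radical_mult_right:
  assumes "x \<in> jacobson_radical" "s \<in> carrier R" shows "x \<otimes> s \<in> jacobson_radical"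
  using assms by (simp add: jacobson_radical_def m_assoc)

text \<open>
  Closure under addition comes from the factorization
  \<open>1 - (x + y) r = (1 - y r u') u\<close> with \<open>u = 1 - x r\<close> and its inverse \<open>u'\<close>, closure under left
  multiplication from \<open>Units_one_minus_mult_swap\<close>.
\<close>

lemma jacobson_radical_ideal: "ideal jacobson_radical R"
proof (rule idealI)
  show "ring R" by (rule ring_axioms)
  show "subgroup jacobson_radical (add_monoid R)"
  proof (rule add.subgroupI)
    show "jacobson_radical \<subseteq> carrier R" by (auto simp: jacobson_radical_def)
    have "\<zero> \<in> jacobson_radical" by (simp add: jacobson_radical_def minus_eq)
    then show "jacobson_radical \<noteq> {}" by blast
  next
    fix x assume x: "x \<in> jacobson_radical"
    then have "x \<otimes> (\<ominus> \<one>) \<in> jacobson_radical" by (intro jacobson_radical_mult_right) auto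
    moreover have "x \<otimes> (\<ominus> \<one>) = \<ominus> x" using jacobson_radical_closed[OF x] by (simp add: r_minus)
    ultimately show "\<ominus> x \<in> jacobson_radical" by simp
  next
    fix x y assume x: "x \<in> jacobson_radical" and y: "y \<in> jacobson_radical"
    note c [simp] = jacobson_radical_closed[OF x] jacobson_radical_closed[OF y]
    have "\<one> \<ominus> (x \<oplus> y) \<otimes> r \<in> Units R" if [simp]: "r \<in> carrier R" for r
    proof -
      define u where "u = \<one> \<ominus> x \<otimes> r"
      have u: "u \<in> Units R" unfolding u_def using x by (simp add: jacobson_radical_unit)
      then have [simp]: "u \<in> carrier R" "inv u \<in> carrier R" by auto
      have "\<one> \<ominus> y \<otimes> (r \<otimes> inv u) \<in> Units R" using y by (simp add: jacobson_radical_unit)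
      then have "(\<one> \<ominus> y \<otimes> (r \<otimes> inv u)) \<otimes> u \<in> Units R" using u by (rule Units_m_closed)
      also have "(\<one> \<ominus> y \<otimes> (r \<otimes> inv u)) \<otimes> u = u \<ominus> y \<otimes> r"
        using u by (simp add: minus_eq l_distr l_minus m_assoc)
      also have "\<dots> = \<one> \<ominus> (x \<oplus> y) \<otimes> r" unfolding u_def using c that by algebra
      finally show ?thesis .
    qed
    then show "x \<oplus> y \<in> jacobson_radical" by (simp add: jacobson_radical_def)
  qed
next
  fix a x assume a: "a \<in> jacobson_radical" and [simp]: "x \<in> carrier R"
  note [simp] = jacobson_radical_closed[OF a]
  show "a \<otimes> x \<in> jacobson_radical" using a by (simp add: jacobson_radical_mult_right)
  have "\<one> \<ominus> (x \<otimes> a) \<otimes> r \<in> Units R" if [simp]: "r \<in> carrier R" for r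
    using Units_one_minus_mult_swap[of "a \<otimes> r" x] jacobson_radical_unit[OF a, of "r \<otimes> x"]
    by (simp add: m_assoc)
  then show "x \<otimes> a \<in> jacobson_radical" by (simp add: jacobson_radical_def)
qed

text \<open>
  If \<open>0\<close> were the only idempotent in \<open>y R\<close>, the exchange property of \<open>y r\<close> would make every
  \<open>1 - y r\<close> right invertible. The right inverse has the same form, hence is right invertible too,
  and \<open>1 - y r\<close> is a unit.
\<close>

lemma exchange_ring_idempotent_multiple:
  assumes ex: "exchange_ring R" and y [simp]: "y \<in> carrier R" and "y \<notin> jacobson_radical"
  obtains r where "r \<in> carrier R" "idempotent_elem R (y \<otimes> r)" "y \<otimes> r \<noteq> \<zero>"
proof (rule ccontr)
  assume "\<not> thesis"
  with that have no: "y \<otimes> r = \<zero>" if "r \<in> carrier R" "idempotent_elem R (y \<otimes> r)" for r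
    using that by blast
  have right_inverse: "\<exists>s\<in>carrier R. (\<one> \<ominus> y \<otimes> r) \<otimes> s = \<one>" if [simp]: "r \<in> carrier R" for r
  proof -
    have "y \<otimes> r \<in> carrier R" by simp
    with ex obtain t s where ts: "t \<in> carrier R" "s \<in> carrier R" "idempotent_elem R (y \<otimes> r \<otimes> t)"
      "\<one> \<ominus> y \<otimes> r \<otimes> t = (\<one> \<ominus> y \<otimes> r) \<otimes> s"
      unfolding exchange_ring_def by metis
    then have "y \<otimes> r \<otimes> t = \<zero>" using no[of "r \<otimes> t"] by (simp add: m_assoc)
    then have "(\<one> \<ominus> y \<otimes> r) \<otimes> s = \<one>" using ts by (simp add: minus_eq)
    then show ?thesis using ts by blast
  qed
  have "\<one> \<ominus> y \<otimes> r \<in> Units R" if [simp]: "r \<in> carrier R" for r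
  proof -
    obtain s where s [simp]: "s \<in> carrier R" and 1: "(\<one> \<ominus> y \<otimes> r) \<otimes> s = \<one>"
      using right_inverse[of r] by auto
    have "s = (\<one> \<ominus> y \<otimes> r) \<otimes> s \<ominus> y \<otimes> (\<ominus> (r \<otimes> s))" using y that s by algebra
    then have "s = \<one> \<ominus> y \<otimes> (\<ominus> (r \<otimes> s))" using 1 by simp
    then obtain t where t [simp]: "t \<in> carrier R" and 2: "s \<otimes> t = \<one>"
      using right_inverse[of "\<ominus> (r \<otimes> s)"] by auto
    have "\<one> \<ominus> y \<otimes> r = (\<one> \<ominus> y \<otimes> r) \<otimes> (s \<otimes> t)" using 2 by simp
    also have "\<dots> = t" using 1 by (simp flip: m_assoc)
    finally show ?thesis using 1 2 unfolding Units_def by auto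
  qed
  then have "y \<in> jacobson_radical" by (simp add: jacobson_radical_def)
  with assms show False by simp
qed

lemma kosan_ring_unit_nil:
  assumes "kosan_ring R" "commutative_image R \<phi>" "\<phi> u \<in> Units R"
  shows "nilpotent_elem R (\<phi> (u ^ 4 - 1))"
proof -
  interpret commutative_image R \<phi> by (rule assms)
  show ?thesis using assms(1,3) unfolding kosan_ring_def unipotent_elem_def
    by (simp add: image_minus image_power image_one)
qed

text \<open>
  The fourth powers of the units \<open>1 + j\<close> and \<open>1 - j\<close> are unipotent. Subtracting cancels the even
  terms and leaves \<open>8 j (1 + j\<^sup>2)\<close>; as \<open>1 + j\<^sup>2\<close> is a unit, \<open>8 j\<close> and hence \<open>2 j\<close> is nilpotent, and
  \<open>(1 + j)^4 - 1\<close> reduces to \<open>j^4\<close> modulo \<open>2 j\<close>.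
\<close>

lemma kosan_ring_jacobson_radical_nilpotent:
  assumes kosan: "kosan_ring R" and j: "j \<in> jacobson_radical"
  shows "nilpotent_elem R j"
proof -
  note [simp] = jacobson_radical_closed[OF j]
  obtain \<phi> :: "int poly \<Rightarrow> 'a" and X where \<phi>: "commutative_image R \<phi>" and X: "\<phi> X = j"
    by (rule element_commutative_image[of j]) auto
  interpret commutative_image R \<phi> by (rule \<phi>)
  have unit: "\<phi> (1 - X * h) \<in> Units R" for h
    using jacobson_radical_unit[OF j, of "\<phi> h"] by (simp add: image_minus image_mult image_one X)
  have plus: "nil ((1 + X) ^ 4 - 1)" using kosan_ring_unit_nil[OF kosan \<phi> unit[of "-1"]] by simp
  have minus: "nil ((1 - X) ^ 4 - 1)" using kosan_ring_unit_nil[OF kosan \<phi> unit[of "1"]] by simp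
  have "8 * X * (1 - X * (- X)) = ((1 + X) ^ 4 - 1) - ((1 - X) ^ 4 - 1)"
    by (simp add: algebra_simps eval_nat_numeral)
  then have "nil (8 * X * (1 - X * (- X)))" using nil_diff[OF plus minus] by (simp only:)
  then have 8: "nil (8 * X)" using unit by (rule nil_cancel_unit)
  have "(2 * X) ^ 3 = 8 * X * X\<^sup>2" by (simp add: algebra_simps eval_nat_numeral)
  then have "nil ((2 * X) ^ 3)" using nil_mult_right[OF 8] by (simp only:)
  then have 2: "nil (2 * X)" by (rule nil_power)
  have "X ^ 4 = ((1 + X) ^ 4 - 1) - 2 * X * (2 + 3 * X + 2 * X\<^sup>2)"
    by (simp add: algebra_simps eval_nat_numeral)
  then have "nil (X ^ 4)" using nil_diff[OF plus nil_mult_right[OF 2]] by (simp only:)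
  then have "nil X" by (rule nil_power)
  then show ?thesis by (simp add: X)
qed

lemma Units_if_mult_Units:
  assumes [simp]: "u \<in> carrier R" "v \<in> carrier R" and uv: "u \<otimes> v \<in> Units R" and vu: "v \<otimes> u \<in> Units R"
  shows "u \<in> Units R"
proof -
  define a b where "a = v \<otimes> inv (u \<otimes> v)" and "b = inv (v \<otimes> u) \<otimes> v"
  have [simp]: "a \<in> carrier R" "b \<in> carrier R" using uv vu by (auto simp: a_def b_def)
  have a: "u \<otimes> a = \<one>" using uv by (simp add: a_def flip: m_assoc)
  have b: "b \<otimes> u = \<one>" using vu by (simp add: b_def m_assoc)
  have "b = b \<otimes> (u \<otimes> a)" using a by simp
  also have "\<dots> = a" using b by (simp flip: m_assoc)
  finally show ?thesis using a b unfolding Units_def by auto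
qed

text \<open>
  Units lift along a surjection whose kernel is contained in the Jacobson radical.
\<close>

lemma kosan_ring_image_mod_jacobson:
  assumes "kosan_ring R" and h: "ring_hom_ring R S h" and surj: "carrier S = h ` carrier R"
    and ker: "\<And>x. x \<in> carrier R \<Longrightarrow> h x = \<zero>\<^bsub>S\<^esub> \<Longrightarrow> x \<in> jacobson_radical"
  shows "kosan_ring S"
proof -
  interpret h: ring_hom_ring R S h by (rule h)
  have lift: "u \<in> Units R" if u [simp]: "u \<in> carrier R" and hu: "h u = \<one>\<^bsub>S\<^esub>" for u
  proof -
    have "h (\<one> \<ominus> u) = \<zero>\<^bsub>S\<^esub>" by (simp add: minus_eq hu h.S.r_neg)
    then have "\<one> \<ominus> u \<in> jacobson_radical" by (rule ker[rotated]) simp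
    from jacobson_radical_unit[OF this, of \<one>] have "\<one> \<ominus> (\<one> \<ominus> u) \<in> Units R" by simp
    moreover have "\<one> \<ominus> (\<one> \<ominus> u) = u" using u by algebra
    ultimately show ?thesis by simp
  qed
  show ?thesis unfolding kosan_ring_def
  proof
    fix U assume U: "U \<in> Units S"
    then obtain V where UV: "U \<in> carrier S" "V \<in> carrier S" "U \<otimes>\<^bsub>S\<^esub> V = \<one>\<^bsub>S\<^esub>" "V \<otimes>\<^bsub>S\<^esub> U = \<one>\<^bsub>S\<^esub>"
      unfolding Units_def by blast
    then obtain u v where uv: "u \<in> carrier R" "v \<in> carrier R" "U = h u" "V = h v" using surj by blast
    have "u \<in> Units R"
      using UV uv by (intro Units_if_mult_Units[of u v] lift) auto
    then have "nilpotent_elem R (u [^] (4::nat) \<ominus> \<one>)"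
      using assms(1) unfolding kosan_ring_def unipotent_elem_def by blast
    then obtain n :: nat where "(u [^] (4::nat) \<ominus> \<one>) [^] n = \<zero>" unfolding nilpotent_elem_def by blast
    then have "h ((u [^] (4::nat) \<ominus> \<one>) [^] n) = \<zero>\<^bsub>S\<^esub>" by simp
    then have "(U [^]\<^bsub>S\<^esub> (4::nat) \<ominus>\<^bsub>S\<^esub> \<one>\<^bsub>S\<^esub>) [^]\<^bsub>S\<^esub> n = \<zero>\<^bsub>S\<^esub>"
      using uv by (simp add: h.hom_nat_pow minus_eq h.S.minus_eq)
    then show "unipotent_elem S (U [^]\<^bsub>S\<^esub> (4::nat))"
      using UV unfolding unipotent_elem_def nilpotent_elem_def by auto
  qed
qed

end

section \<open>Kosan rings in which nonzero right ideals contain nonzero idempotents\<close>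

context ring begin

text \<open>
  The commutative image makes a one-sided inverse two-sided.
\<close>

lemma kosan_ring_image_unit_nil:
  assumes kosan: "kosan_ring R" and \<phi>: "commutative_image R \<phi>" and uv: "\<phi> (u * v - 1) = \<zero>"
  shows "nilpotent_elem R (\<phi> (u ^ 4 - 1))"
proof -
  interpret commutative_image R \<phi> by (rule \<phi>)
  have "\<phi> (u * v) = \<phi> ((u * v - 1) + 1)" by simp
  also have "\<dots> = \<one>" using uv by (simp only: image_add image_one) simp
  finally have "\<phi> u \<otimes> \<phi> v = \<one>" by (simp only: image_mult)
  then have "\<phi> u \<in> Units R" unfolding Units_def using image_commute[of u v] by auto
  then show ?thesis by (rule kosan_ring_unit_nil[OF kosan \<phi>])
qed

text \<open>
  In the corner with identity \<open>g\<close>, the equation \<open>m\<^sup>2 + m + g = 0\<close> makes \<open>m\<close> a unit of order three.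
  Extended by \<open>1 - g\<close> it is a unit \<open>u\<close> of the ring with \<open>u^4 = u\<close>, so \<open>m - g\<close> is nilpotent. But
  \<open>(m - g) (m + 2 g) = - 3 g\<close>.
\<close>

lemma kosan_order_three_corner:
  assumes kosan: "kosan_ring R" and \<phi>: "commutative_image R \<phi>"
    and g: "\<phi> (g * g - g) = \<zero>" and gm: "\<phi> (g * m - m) = \<zero>" and m: "\<phi> (m * m + m + g) = \<zero>"
  shows "nilpotent_elem R (\<phi> (3 * g))"
proof -
  interpret commutative_image R \<phi> by (rule \<phi>)
  note gm' = nil_if_image_zero[OF gm] and g' = nil_if_image_zero[OF g] and m' = nil_if_image_zero[OF m]
  let ?u = "1 - g + m" and ?v = "1 - 2 * g - m"
  have "?u * ?v - 1 = (g * g - g) * 2 + (g * m - m) * (- 1) + (m * m + m + g) * (- 1)"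
    by (simp add: algebra_simps)
  then have uv: "\<phi> (?u * ?v - 1) = \<zero>" using g gm m by (simp only: image_zero_add image_zero_mult(1))
  from kosan_ring_image_unit_nil[OF kosan \<phi> this] have "nil (?u ^ 4 - 1)" .
  moreover have "m - g = (?u ^ 4 - 1) + (?u * ?v - 1) * (- ?u)
      + ((g * g - g) + (g * m - m) * (- 2) + (m * m + m + g)) * (- ?u\<^sup>2)"
    by (simp add: algebra_simps eval_nat_numeral)
  ultimately have "nil (m - g)"
    using nil_if_image_zero[OF uv] g' gm' m' by (simp only: nil_add nil_mult_right)
  moreover have "3 * g = (m - g) * (- m - 2 * g) + (m * m + m + g) + (g * m - m) + (g * g - g) * (- 2)"
    by (simp add: algebra_simps)
  ultimately show ?thesis using g' gm' m' by (simp only: nil_add nil_mult_right)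
qed

text \<open>
  Here \<open>m\<^sup>2 = m + g\<close> gives \<open>m^4 - g = 3 m + g\<close>, which is nilpotent by the Kosan condition, and
  \<open>(3 m + g) (3 m - 4 g) = 5 g\<close>.
\<close>

lemma kosan_fibonacci_corner:
  assumes kosan: "kosan_ring R" and \<phi>: "commutative_image R \<phi>"
    and g: "\<phi> (g * g - g) = \<zero>" and gm: "\<phi> (g * m - m) = \<zero>" and m: "\<phi> (m * m - m - g) = \<zero>"
  shows "nilpotent_elem R (\<phi> (5 * g))"
proof -
  interpret commutative_image R \<phi> by (rule \<phi>)
  note gm' = nil_if_image_zero[OF gm] and g' = nil_if_image_zero[OF g] and m' = nil_if_image_zero[OF m]
  let ?u = "1 - g + m" and ?v = "1 - 2 * g + m"
  have "?u * ?v - 1 = (g * g - g) * 2 + (g * m - m) * (- 3) + (m * m - m - g)"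
    by (simp add: algebra_simps)
  then have "\<phi> (?u * ?v - 1) = \<zero>" using g gm m by (simp only: image_zero_add image_zero_mult(1))
  then have "nil (?u ^ 4 - 1)" by (rule kosan_ring_image_unit_nil[OF kosan \<phi>])
  moreover have "3 * m + g = (?u ^ 4 - 1) + (m * m - m - g) * (- 1)
     + ((g * g - g) + (g * m - m) * (- 2) + (m * m - m - g)) * (- ?u\<^sup>2 - (1 + m))"
    by (simp add: algebra_simps eval_nat_numeral)
  ultimately have "nil (3 * m + g)" using g' gm' m' by (simp only: nil_add nil_mult_right)
  moreover have "5 * g = (3 * m + g) * (3 * m - 4 * g) + (m * m - m - g) * (- 9) + (g * m - m) * 9 + (g * g - g) * 4"
    by (simp add: algebra_simps)
  ultimately show ?thesis using g' gm' m' by (simp only: nil_add nil_mult_right)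
qed

text \<open>
  The elements \<open>x y, x, y, y x\<close> form a system of 2 by 2 matrix units \<open>E\<^sub>1\<^sub>1, E\<^sub>1\<^sub>2, E\<^sub>2\<^sub>1, E\<^sub>2\<^sub>2\<close> with identity
  \<open>g\<close>. The matrices \<open>m\<close> with rows \<open>(0, -1), (1, -1)\<close> and \<open>m'\<close> with rows \<open>(1, 1), (1, 0)\<close> satisfy the
  equations of the two preceding lemmas, so \<open>3 g\<close> and \<open>5 g\<close>, and therefore \<open>g\<close>, are nilpotent. Two
  matrices are needed, as over a field of characteristic 3 or 5 the fourth power of one of them is
  unipotent.
\<close>

lemma kosan_ring_no_matrix_units:
  assumes kosan: "kosan_ring R" and c [simp]: "x \<in> carrier R" "y \<in> carrier R"
    and sq: "x \<otimes> x = \<zero>" "y \<otimes> y = \<zero>" and xyx: "x \<otimes> y \<otimes> x = x" and yxy: "y \<otimes> x \<otimes> y = y"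
  shows "x = \<zero>"
proof -
  define g where "g = x \<otimes> y \<oplus> y \<otimes> x"
  define m where "m = y \<ominus> x \<ominus> y \<otimes> x"
  define m' where "m' = x \<otimes> y \<oplus> x \<oplus> y"
  have [simp]: "g \<in> carrier R" "m \<in> carrier R" "m' \<in> carrier R" by (simp_all add: g_def m_def m'_def)
  have tail: "x \<otimes> (x \<otimes> z) = \<zero>" "y \<otimes> (y \<otimes> z) = \<zero>" "x \<otimes> (y \<otimes> (x \<otimes> z)) = x \<otimes> z"
    "y \<otimes> (x \<otimes> (y \<otimes> z)) = y \<otimes> z" if "z \<in> carrier R" for z
    using sq xyx yxy that by (simp_all flip: m_assoc)
  have "x \<otimes> (y \<otimes> x) = x" "y \<otimes> (x \<otimes> y) = y" using xyx yxy by (simp_all add: m_assoc)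
  note rules = sq this tail l_distr r_distr minus_eq l_minus r_minus m_assoc minus_add
  have gg: "g \<otimes> g = g" by (simp add: g_def rules)
  have gm: "g \<otimes> m = m" "m \<otimes> g = m" by (simp_all add: g_def m_def rules a_ac)
  have gm': "g \<otimes> m' = m'" "m' \<otimes> g = m'" by (simp_all add: g_def m'_def rules a_ac)
  have mm: "m \<otimes> m \<oplus> m \<oplus> g = \<zero>"
  proof -
    have mm: "m \<otimes> m = \<ominus> (y \<otimes> x) \<ominus> y \<ominus> x \<otimes> y \<oplus> x \<oplus> y \<otimes> x"
      by (simp add: m_def rules a_ac)
    have "x \<otimes> y \<in> carrier R" "y \<otimes> x \<in> carrier R" by simp_all
    then show ?thesis unfolding mm unfolding m_def g_def using c by algebra
  qed
  have mm': "m' \<otimes> m' = m' \<oplus> g" by (simp add: g_def m'_def rules a_ac)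
  obtain \<phi> :: "int poly poly \<Rightarrow> 'a" and G M where \<phi>: "commutative_image R \<phi>" and GM: "\<phi> G = g" "\<phi> M = m"
    by (rule commuting_pair_commutative_image[of g m]) (simp_all add: gm)
  interpret \<phi>: commutative_image R \<phi> by (rule \<phi>)
  have G0: "\<phi> (G * G - G) = \<zero>" by (simp add: \<phi>.image_minus \<phi>.image_mult GM gg minus_eq r_neg)
  have "\<phi>.nil (3 * G)"
    by (rule kosan_order_three_corner[OF kosan \<phi> G0, of M])
       (simp_all add: \<phi>.image_minus \<phi>.image_add \<phi>.image_mult GM gm mm minus_eq r_neg)
  then have 3: "nilpotent_elem R ([(3::int)] \<cdot> g)"
    using \<phi>.image_of_int[of 3] by (simp add: \<phi>.image_mult GM add_pow_ldistr_int)
  obtain \<psi> :: "int poly poly \<Rightarrow> 'a" and G' M' where \<psi>: "commutative_image R \<psi>" and GM': "\<psi> G' = g" "\<psi> M' = m'"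
    by (rule commuting_pair_commutative_image[of g m']) (simp_all add: gm')
  interpret \<psi>: commutative_image R \<psi> by (rule \<psi>)
  have G0': "\<psi> (G' * G' - G') = \<zero>" by (simp add: \<psi>.image_minus \<psi>.image_mult GM' gg minus_eq r_neg)
  have "\<psi> (M' * M' - M' - G') = m' \<oplus> g \<ominus> m' \<ominus> g"
    by (simp add: \<psi>.image_minus \<psi>.image_mult GM' mm')
  also have "\<dots> = \<zero>" using \<open>g \<in> carrier R\<close> \<open>m' \<in> carrier R\<close> by algebra
  finally have "\<psi>.nil (5 * G')"
    by (rule kosan_fibonacci_corner[OF kosan \<psi> G0', of M', rotated])
       (simp_all add: \<psi>.image_minus \<psi>.image_mult GM' gm' minus_eq r_neg)
  moreover have "\<psi>.nil (3 * G')"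
    using 3 \<psi>.image_of_int[of 3] by (simp add: \<psi>.image_mult GM' add_pow_ldistr_int)
  moreover have "G' = 3 * G' * 2 + 5 * G' * (- 1)" by simp
  ultimately have "\<psi>.nil G'" using \<psi>.nil_add \<psi>.nil_mult_right by metis
  then have "g = \<zero>" using \<psi>.nil_idempotent_zero G0' GM' by metis
  moreover have "x = g \<otimes> x" by (simp add: g_def rules)
  ultimately show ?thesis using c by simp
qed

text \<open>
  From \<open>x\<^sup>2 = 0\<close> and a nonzero idempotent \<open>x s\<close> matrix units are built. After replacing \<open>s\<close> by
  \<open>r = s x s\<close> one has \<open>r x r = r\<close>, and \<open>x r x\<close> has square zero. The factor \<open>1 - r x\<close> in
  \<open>r (1 - r x)\<close> makes the square of the opposite matrix unit vanish as well.
\<close>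

lemma kosan_semipotent_reduced:
  assumes kosan: "kosan_ring R"
    and semi: "\<And>y. y \<in> carrier R \<Longrightarrow> y \<noteq> \<zero> \<Longrightarrow> \<exists>r\<in>carrier R. idempotent_elem R (y \<otimes> r) \<and> y \<otimes> r \<noteq> \<zero>"
    and x [simp]: "x \<in> carrier R" and xx: "x \<otimes> x = \<zero>"
  shows "x = \<zero>"
proof (rule ccontr)
  assume "x \<noteq> \<zero>"
  then obtain s where s [simp]: "s \<in> carrier R" and e: "x \<otimes> s \<otimes> (x \<otimes> s) = x \<otimes> s" "x \<otimes> s \<noteq> \<zero>"
    using semi[OF x] unfolding idempotent_elem_def by blast
  define r where "r = s \<otimes> x \<otimes> s"
  have r [simp]: "r \<in> carrier R" by (simp add: r_def)
  have xr: "x \<otimes> r = x \<otimes> s" using e(1) by (simp add: r_def m_assoc)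
  have rxr: "r \<otimes> (x \<otimes> r) = r" using e(1) unfolding xr by (simp add: r_def m_assoc)
  have tail: "x \<otimes> (x \<otimes> z) = \<zero>" "r \<otimes> (x \<otimes> (r \<otimes> z)) = r \<otimes> z" if "z \<in> carrier R" for z
    using xx rxr that by (simp_all flip: m_assoc)
  note rules = xx rxr tail l_distr r_distr minus_eq l_minus r_minus m_assoc minus_add
  let ?a = "x \<otimes> r \<otimes> x" and ?b = "r \<ominus> r \<otimes> r \<otimes> x"
  have "?a = \<zero>"
    by (rule kosan_ring_no_matrix_units[OF kosan, of ?a ?b]) (simp_all add: rules r_neg)
  then have "?a \<otimes> r = \<zero>" by simp
  then have "x \<otimes> r = \<zero>" by (simp add: rules)
  with xr e show False by simp
qed

end

locale reduced_ring = ring +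
  assumes square_zero: "x \<in> carrier R \<Longrightarrow> x \<otimes> x = \<zero> \<Longrightarrow> x = \<zero>"
begin

lemma nilpotent_zero:
  assumes "nilpotent_elem R x" shows "x = \<zero>"
proof -
  have x [simp]: "x \<in> carrier R" using assms by (simp add: nilpotent_elem_def)
  have "x [^] Suc n = \<zero> \<Longrightarrow> x = \<zero>" for n
  proof (induction n)
    case (Suc n)
    have "x [^] Suc n \<otimes> x [^] Suc n = x [^] Suc (Suc n) \<otimes> x [^] n"
      by (simp only: nat_pow_mult[OF x]) simp
    also have "\<dots> = \<zero>" using Suc.prems by (simp only:) simp
    finally show ?case using square_zero[of "x [^] Suc n"] Suc.IH by simp
  qed simp
  moreover obtain n :: nat where "x [^] n = \<zero>" using assms by (auto simp: nilpotent_elem_def)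
  then have "x [^] Suc n = \<zero>" by simp
  ultimately show ?thesis by blast
qed

text \<open>
  With \<open>f = 1 - e\<close> the elements \<open>e x f\<close> and \<open>f x e\<close> have square zero.
\<close>

lemma idempotent_central:
  assumes "idempotent_elem R e" and x [simp]: "x \<in> carrier R"
  shows "e \<otimes> x = x \<otimes> e"
proof -
  have e [simp]: "e \<in> carrier R" and ee: "e \<otimes> e = e" using assms by (auto simp: idempotent_elem_def)
  define f where "f = \<one> \<ominus> e"
  have f [simp]: "f \<in> carrier R" by (simp add: f_def)
  have ef: "e \<otimes> f = \<zero>" "f \<otimes> e = \<zero>"
    by (simp_all add: f_def minus_eq l_distr r_distr l_minus r_minus ee r_neg)
  have tail: "e \<otimes> (f \<otimes> z) = \<zero>" "f \<otimes> (e \<otimes> z) = \<zero>" if "z \<in> carrier R" for z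
    using ef that by (simp_all flip: m_assoc)
  have "e \<otimes> x \<otimes> f = \<zero>" by (rule square_zero) (simp_all add: m_assoc tail)
  moreover have "e \<otimes> x \<otimes> f = e \<otimes> x \<ominus> e \<otimes> x \<otimes> e"
    by (simp add: f_def minus_eq r_distr r_minus m_assoc)
  ultimately have "e \<otimes> x = e \<otimes> x \<otimes> e" using r_right_minus_eq[of "e \<otimes> x" "e \<otimes> x \<otimes> e"] by simp
  also have "\<dots> = x \<otimes> e"
  proof -
    have "f \<otimes> x \<otimes> e = \<zero>" by (rule square_zero) (simp_all add: m_assoc tail)
    moreover have "f \<otimes> x \<otimes> e = x \<otimes> e \<ominus> e \<otimes> x \<otimes> e"
      by (simp add: f_def minus_eq l_distr l_minus m_assoc)
    ultimately show ?thesis using r_right_minus_eq[of "x \<otimes> e" "e \<otimes> x \<otimes> e"] by simp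
  qed
  finally show ?thesis .
qed

text \<open>
  Suppose \<open>a b \<noteq> 0\<close> for \<open>b = a^4 - 1\<close> and let \<open>e = a b r\<close> be a nonzero, hence central, idempotent.
  Then \<open>a e\<close> is a unit in the corner of \<open>e\<close> and extends by \<open>1 - e\<close> to a unit \<open>u\<close>. In a reduced
  ring unipotent means equal to 1, so \<open>e = e u^4 = e a^4\<close>, that is \<open>e b = 0\<close>, contrary to
  \<open>e = a (e b) r\<close>.
\<close>

lemma kosan_semipotent_fifth_power:
  assumes kosan: "kosan_ring R"
    and semi: "\<And>y. y \<in> carrier R \<Longrightarrow> y \<noteq> \<zero> \<Longrightarrow> \<exists>r\<in>carrier R. idempotent_elem R (y \<otimes> r) \<and> y \<otimes> r \<noteq> \<zero>"
    and a [simp]: "a \<in> carrier R"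
  shows "a [^] (5::nat) \<ominus> a = \<zero>"
proof (rule ccontr)
  define b where "b = a [^] (4::nat) \<ominus> \<one>"
  have [simp]: "b \<in> carrier R" by (simp add: b_def)
  have ab: "a \<otimes> b = a [^] (5::nat) \<ominus> a"
    by (simp add: b_def r_distr minus_eq r_minus eval_nat_numeral nat_pow_Suc2 m_assoc del: nat_pow_Suc)
  assume "a [^] (5::nat) \<ominus> a \<noteq> \<zero>"
  then obtain r where r [simp]: "r \<in> carrier R" and "idempotent_elem R (a \<otimes> b \<otimes> r)" "a \<otimes> b \<otimes> r \<noteq> \<zero>"
    using semi[of "a \<otimes> b"] ab by auto
  define e where "e = a \<otimes> b \<otimes> r"
  have idem: "idempotent_elem R e" and e0: "e \<noteq> \<zero>" unfolding e_def by fact+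
  have e [simp]: "e \<in> carrier R" and ee: "e \<otimes> e = e" using idem by (auto simp: idempotent_elem_def)
  note central = idempotent_central[OF idem]
  define c where "c = b \<otimes> r \<otimes> e"
  have c [simp]: "c \<in> carrier R" by (simp add: c_def)
  have ec: "e \<otimes> c = c" and ce: "c \<otimes> e = c"
    using central[of c] by (simp_all add: c_def m_assoc ee)
  have ac: "a \<otimes> c = e" using ee by (simp add: c_def e_def m_assoc)
  \<comment> \<open>Right inverses in the corner are left inverses, because the idempotent \<open>c a\<close> is central.\<close>
  have ca: "c \<otimes> a = e"
  proof -
    have "idempotent_elem R (c \<otimes> a)"
    proof -
      have "c \<otimes> a \<otimes> (c \<otimes> a) = c \<otimes> (a \<otimes> c) \<otimes> a" by (simp add: m_assoc)
      also have "\<dots> = c \<otimes> a" by (simp add: ac ce)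
      finally show ?thesis by (simp add: idempotent_elem_def)
    qed
    note swap = idempotent_central[OF this a]
    have "e = a \<otimes> c \<otimes> (a \<otimes> c)" by (simp add: ac ee)
    also have "\<dots> = a \<otimes> (c \<otimes> a) \<otimes> c" by (simp add: m_assoc)
    also have "\<dots> = c \<otimes> a \<otimes> (a \<otimes> c)" by (simp add: m_assoc flip: swap)
    also have "\<dots> = c \<otimes> (a \<otimes> e)" by (simp add: ac m_assoc)
    also have "\<dots> = c \<otimes> (e \<otimes> a)" by (simp add: central)
    also have "\<dots> = c \<otimes> e \<otimes> a" by (simp add: m_assoc)
    finally show ?thesis by (simp add: ce)
  qed
  define f where "f = \<one> \<ominus> e"
  have f [simp]: "f \<in> carrier R" by (simp add: f_def)
  have ef: "e \<otimes> f = \<zero>" "f \<otimes> e = \<zero>" "f \<otimes> f = f"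
    by (simp_all add: f_def minus_eq l_distr r_distr l_minus r_minus ee r_neg)
  have e_f: "e \<oplus> f = \<one>" using e using a_lcomm[of e \<one> "\<ominus> e"] by (simp add: f_def minus_eq r_neg)
  have fc: "f \<otimes> c = \<zero>" using ec ef by (metis c e f l_null m_assoc)
  have cf: "c \<otimes> f = \<zero>" using ce ef by (metis c e f r_null m_assoc)
  define u where "u = a \<otimes> e \<oplus> f"
  define v where "v = c \<oplus> f"
  have [simp]: "u \<in> carrier R" "v \<in> carrier R" by (simp_all add: u_def v_def)
  have "u \<otimes> v = \<one>"
    by (simp add: u_def v_def l_distr r_distr m_assoc ec ef fc ac e_f)
  moreover have fae: "f \<otimes> a \<otimes> e = \<zero>"
    using ef by (simp add: m_assoc flip: central) (simp flip: m_assoc)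
  have "v \<otimes> u = \<one>"
    using ca by (simp add: u_def v_def l_distr r_distr ef cf fae e_f ee flip: m_assoc)
  ultimately have "u \<in> Units R" unfolding Units_def by auto
  then have "u [^] (4::nat) \<ominus> \<one> = \<zero>"
    using kosan nilpotent_zero unfolding kosan_ring_def unipotent_elem_def by blast
  then have u4: "u [^] (4::nat) = \<one>" by simp
  have ue: "e \<otimes> u = e \<otimes> a"
    by (simp add: u_def r_distr ef central ee m_assoc)
  have pow: "e \<otimes> u [^] n = e \<otimes> a [^] n" for n :: nat
  proof (induction n)
    case (Suc n)
    have "e \<otimes> u [^] Suc n = e \<otimes> u [^] n \<otimes> u" by (simp add: m_assoc)
    also have "\<dots> = a [^] n \<otimes> (e \<otimes> u)" by (simp add: Suc central m_assoc)
    also have "\<dots> = e \<otimes> a [^] n \<otimes> a" by (simp add: ue central[of "a [^] n"] m_assoc)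
    finally show ?case by (simp add: m_assoc)
  qed simp
  have "e \<otimes> b = \<zero>" using pow[of 4] u4 by (simp add: b_def minus_eq r_distr r_minus r_neg)
  then have "e \<otimes> (b \<otimes> r) = \<zero>" by (simp flip: m_assoc)
  then have "c = \<zero>" using central[of "b \<otimes> r"] by (simp add: c_def)
  then show False using ac e0 by simp
qed

end

section \<open>Exchange Kosan rings\<close>

context ring begin

text \<open>
  The quotient by the Jacobson radical is reduced and satisfies \<open>x^5 = x\<close>, so \<open>a^5 - a\<close> lies in the
  radical, which consists of nilpotents. Nonzero right ideals of the quotient contain nonzero
  idempotents because those found in \<open>R\<close> survive: an idempotent \<open>e\<close> in the radical makes
  \<open>1 - e\<close> a unit, and \<open>e (1 - e) = 0\<close>.
\<close>

lemma exchange_kosan_fifth_power: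
  assumes exchange: "exchange_ring R" and kosan: "kosan_ring R" and a [simp]: "a \<in> carrier R"
  shows "nilpotent_elem R (a [^] (5::nat) \<ominus> a)"
proof -
  interpret J: ideal jacobson_radical R by (rule jacobson_radical_ideal)
  define S where "S = R Quot jacobson_radical"
  define h where "h = (+>) jacobson_radical"
  have h: "ring_hom_ring R S h" unfolding S_def h_def by (rule J.rcos_ring_hom_ring)
  interpret h: ring_hom_ring R S h by (rule h)
  have surj: "carrier S = h ` carrier R"
    unfolding S_def h_def FactRing_simps by auto
  have ker: "x \<in> jacobson_radical" if "x \<in> carrier R" "h x = \<zero>\<^bsub>S\<^esub>" for x
    using that J.rcos_const_imp_mem unfolding S_def h_def FactRing_def by simp
  have kosan': "kosan_ring S" by (rule kosan_ring_image_mod_jacobson[OF kosan h surj ker])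
  have semi: "\<exists>r\<in>carrier S. idempotent_elem S (y \<otimes>\<^bsub>S\<^esub> r) \<and> y \<otimes>\<^bsub>S\<^esub> r \<noteq> \<zero>\<^bsub>S\<^esub>"
    if y: "y \<in> carrier S" "y \<noteq> \<zero>\<^bsub>S\<^esub>" for y
  proof -
    obtain x where x [simp]: "x \<in> carrier R" and yx: "y = h x" using y(1) unfolding surj by blast
    have "x \<notin> jacobson_radical"
      using y(2) J.a_rcos_const unfolding yx S_def h_def FactRing_def by auto
    then obtain r where r [simp]: "r \<in> carrier R" and e: "idempotent_elem R (x \<otimes> r)" "x \<otimes> r \<noteq> \<zero>"
      by (rule exchange_ring_idempotent_multiple[OF exchange x])
    define e where "e = x \<otimes> r"
    have [simp]: "e \<in> carrier R" and ee: "e \<otimes> e = e" using e by (auto simp: e_def idempotent_elem_def)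
    have "h e \<noteq> \<zero>\<^bsub>S\<^esub>"
    proof
      assume "h e = \<zero>\<^bsub>S\<^esub>"
      then have "\<one> \<ominus> e \<otimes> \<one> \<in> Units R" using ker[of e] jacobson_radical_unit[of e \<one>] by simp
      then have u: "\<one> \<ominus> e \<in> Units R" by simp
      have "e = e \<otimes> ((\<one> \<ominus> e) \<otimes> inv (\<one> \<ominus> e))" using u by simp
      also have "\<dots> = (e \<otimes> (\<one> \<ominus> e)) \<otimes> inv (\<one> \<ominus> e)" using u by (simp add: m_assoc)
      also have "e \<otimes> (\<one> \<ominus> e) = \<zero>" by (simp add: minus_eq r_distr r_minus ee r_neg)
      finally show False using e(2) u by (simp add: e_def)
    qed
    moreover have "h e = y \<otimes>\<^bsub>S\<^esub> h r" by (simp add: e_def yx)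
    moreover have "idempotent_elem S (h e)"
      unfolding idempotent_elem_def by (simp add: ee flip: h.hom_mult)
    ultimately show ?thesis using h.hom_closed[OF r] by metis
  qed
  interpret S: reduced_ring S
    by unfold_locales (rule h.S.kosan_semipotent_reduced[OF kosan' semi])
  have "h a [^]\<^bsub>S\<^esub> (5::nat) \<ominus>\<^bsub>S\<^esub> h a = \<zero>\<^bsub>S\<^esub>"
    by (rule S.kosan_semipotent_fifth_power[OF kosan' semi]) auto
  then have "h (a [^] (5::nat) \<ominus> a) = \<zero>\<^bsub>S\<^esub>"
    by (simp add: h.hom_nat_pow minus_eq h.S.minus_eq)
  then have "a [^] (5::nat) \<ominus> a \<in> jacobson_radical" by (rule ker[rotated]) simp
  then show ?thesis by (rule kosan_ring_jacobson_radical_nilpotent[OF kosan])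
qed

end

theorem theorem5p4:
  fixes R :: "('a, 'b) ring_scheme"
  assumes "ring R"
  shows "zhou_nil_clean R \<longleftrightarrow> exchange_ring R \<and> kosan_ring R"
proof -
  interpret ring R by (rule assms)
  show ?thesis
    using zhou_nil_clean_fifth_power fifth_power_exchange_ring fifth_power_kosan_ring
      exchange_kosan_fifth_power fifth_power_zhou_nil_clean
    by blast
qed

end
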